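(* Let $\Bbbk$ be a field, $d=3$, $R=\Bbbk[x_1,x_2,x_3]_{(x_1,x_2,x_3)}$, and $I=(x_1^2x_3,\;x_2^2x_3,\;x_1x_2)\subset R$, with Newton polyhedron $\Gamma$. Then the statement $$\text{for every }0\le k\le d-1:\qquad c_{d-(k+1)}(I)=\sum_{F\in\mathscr{F}(k)}\ \min_{\substack{G\subseteq F\text{ bounded face}\\ \dim(G)=k}}\bigl\{\operatorname{Vol}(G,F)\bigr\}$$ is false, i.e. the equality fails for at least one $k\in\{0,1,2\}$. In particular, the Achilles–Manaresi conjecture (which asserts that this statement holds for every nonzero proper monomial ideal $I$ of $\Bbbk[x_1,\ldots,x_d]_{(x_1,\ldots,x_d)}$, for every $d$) does not hold in dimension $d=3$.
   Context: Multiplicity sequence. Let $R=\Bbbk[x_1,\ldots,x_d]_{(x_1,\ldots,x_d)}$ with maximal ideal $\mathfrak{m}=(x_1,\ldots,x_d)$ and let $\lambda_R$ denote length. For a nonzero ideal $I\subseteq R$, the function $$H(u,v)=\sum_{i=0}^u\lambda_R\left(\frac{I^i}{\mathfrak{m}^{v+1}I^i+I^{i+1}}\right)$$ (the second sum transform of the Hilbert function of $\operatorname{gr}_{\mathfrak m}(\operatorname{gr}_I(R))$) agrees for $u,v\gg0$ with a polynomial in $\mathbb{Q}[u,v]$ of degree at most $d$. Writing it as $\sum_{i=0}^d\frac{c_i(I)}{(d-i)!\,i!}u^{d-i}v^i+(\text{terms of degree}<d)$, the nonnegative integers $c_0(I),\ldots,c_d(I)$ are the multiplicity sequence of $I$.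 Newton polyhedron. For a nonzero proper monomial ideal $I$, $\Gamma=\operatorname{conv}(\mathbf v\mid\mathbf x^{\mathbf v}\in I)\subseteq\mathbb{R}^d$. Let $\mathbf e_1,\ldots,\mathbf e_d$ be the standard basis of $\mathbb{R}^d$. A face $F$ of $\Gamma$ with vertices $\mathbf b_1,\ldots,\mathbf b_g$ is of the form $F=\operatorname{conv}(\mathbf b_1,\ldots,\mathbf b_g)+\mathbb{R}_{\ge0}\mathbf e_{u_1}+\cdots+\mathbb{R}_{\ge0}\mathbf e_{u_k}$; the $\mathbf e_{u_j}$ are called the unbounded directions of $F$. A facet is a face of dimension $d-1$. For $0\le k\le d-1$, $\mathscr{F}(k)$ is the set of facets $F$ of $\Gamma$ (bounded or unbounded) such that (i) $F$ has at least $d-(k+1)$ unbounded directions, and (ii) $F$ contains at least one bounded face of dimension $k$. For $F\in\mathscr{F}(k)$ and a $k$-dimensional bounded face $G\subseteq F$, let $M_1,\ldots,M_q$ be those sets consisting of $d-(k+1)$ unbounded directions of $F$ for which the coordinate projection $\pi_i:\mathbb{R}^d\to\sum_{\mathbf e_j\notin M_i}\mathbb{R}\mathbf e_j$ sends $G$ to a $k$-dimensional convex set $\pi_i(G)$. Define $$\operatorname{Vol}(G,F)=(k+1)!\,\min_{1\le i\le q}\bigl\{\operatorname{Vol}_{k+1}\bigl(\operatorname{conv}(\{\mathbf 0\}\cup\pi_i(G))\bigr)\bigr\},$$ where $\operatorname{Vol}_{k+1}$ is $(k+1)$-dimensional volume. *)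

theory Defs
  imports
    "HOL-Analysis.Analysis"
    "HOL-Library.Poly_Mapping"
    "HOL-Library.Numeral_Type"
    "HOL-Library.Extended_Nat"
    "HOL-Library.Extended_Real"
    "HOL-Computational_Algebra.Fraction_Field"
    "HOL-Algebra.Ideal_Product"
    "HOL-Algebra.Module"
    "HOL-Algebra.Algebraic_Closure_Type"
begin

unbundle no Formal_Power_Series.fps_syntax

section \<open>Length of modules and the multiplicity sequence\<close>

text \<open>The length is the supremum of the lengths \<open>n\<close> of strict chains of submodules
  \<open>N 0 \<subset> \<dots> \<subset> N n\<close>; it is \<open>\<infinity>\<close> if these are unbounded.\<close>

definition module_length :: "('r, 'x) ring_scheme \<Rightarrow> ('r, 'm) module \<Rightarrow> enat" where
  "module_length R M =
     (SUP n \<in> {n::nat. \<exists>N. (\<forall>i\<le>n. submodule (N i) R M) \<and> (\<forall>i<n. N i \<subset> N (Suc i))}. enat n)"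

text \<open>The quotient \<open>N / P\<close> of additive subgroups \<open>P \<subseteq> N\<close> of \<open>R\<close> that are closed under
  multiplication by \<open>R\<close>, as an \<open>R\<close>-module of cosets. Module records carry ring
  multiplication and unit fields, which the module structure never uses.\<close>

definition quotient_module :: "('r, 'x) ring_scheme \<Rightarrow> 'r set \<Rightarrow> 'r set \<Rightarrow> ('r, 'r set) module" where
  "quotient_module R N P =
     \<lparr>carrier = (\<lambda>x. P +>\<^bsub>R\<^esub> x) ` N,
      mult = undefined, one = undefined,
      zero = P,
      add = set_add R,
      smult = (\<lambda>a C. \<Union>x\<in>C. P +>\<^bsub>R\<^esub> (a \<otimes>\<^bsub>R\<^esub> x))\<rparr>"

primrec ideal_power :: "('r, 'x) ring_scheme \<Rightarrow> 'r set \<Rightarrow> nat \<Rightarrow> 'r set" where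
  "ideal_power R I 0 = carrier R"
| "ideal_power R I (Suc n) = ideal_prod R I (ideal_power R I n)"

definition hilbert_sum :: "('r, 'x) ring_scheme \<Rightarrow> 'r set \<Rightarrow> 'r set \<Rightarrow> nat \<Rightarrow> nat \<Rightarrow> enat" where
  "hilbert_sum R \<mm> I u v =
     (\<Sum>i=0..u. module_length R
        (quotient_module R (ideal_power R I i)
           (ideal_prod R (ideal_power R \<mm> (v + 1)) (ideal_power R I i)
              <+>\<^bsub>R\<^esub> ideal_power R I (i + 1))))"

text \<open>A polynomial \<open>\<Sum> a i j u\<^sup>i v\<^sup>j\<close> of degree at most \<open>d\<close> in \<open>\<rat>[u,v]\<close> is represented by its
  coefficients \<open>a i j\<close> with \<open>i + j \<le> d\<close>.\<close>

definition is_hilbert_polynomial ::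
    "nat \<Rightarrow> ('r, 'x) ring_scheme \<Rightarrow> 'r set \<Rightarrow> 'r set \<Rightarrow> (nat \<Rightarrow> nat \<Rightarrow> rat) \<Rightarrow> bool" where
  "is_hilbert_polynomial d R \<mm> I a \<longleftrightarrow>
     (\<exists>n0. \<forall>u\<ge>n0. \<forall>v\<ge>n0.
        ereal_of_enat (hilbert_sum R \<mm> I u v) =
        ereal (real_of_rat
          (\<Sum>(i, j) \<in> {(i, j). i + j \<le> d}. a i j * of_nat u ^ i * of_nat v ^ j)))"

definition mult_seq :: "nat \<Rightarrow> ('r, 'x) ring_scheme \<Rightarrow> 'r set \<Rightarrow> 'r set \<Rightarrow> nat \<Rightarrow> nat" where
  "mult_seq d R \<mm> I i =
     (THE c::nat. \<exists>a. is_hilbert_polynomial d R \<mm> I a \<and>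
        a (d - i) i = of_nat c / (fact (d - i) * fact i))"

section \<open>The localized polynomial ring and its monomial ideals\<close>

text \<open>Monomials in the variables indexed by \<open>'n\<close> are exponent vectors \<open>'n \<Rightarrow>\<^sub>0 nat\<close>; the number
  of variables is \<open>CARD('n)\<close>. The order on \<open>'n\<close> is only needed for the library's proof that
  polynomials form an integral domain.\<close>

type_synonym ('k, 'n) mpoly = "('n \<Rightarrow>\<^sub>0 nat) \<Rightarrow>\<^sub>0 'k"

definition monomial :: "('n::{finite,linorder} \<Rightarrow>\<^sub>0 nat) \<Rightarrow> ('k::field, 'n) mpoly" where
  "monomial v = Poly_Mapping.single v 1"

definition poly_var :: "'n::{finite,linorder} \<Rightarrow> ('k::field, 'n) mpoly" where
  "poly_var j = monomial (Poly_Mapping.single j 1)"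

definition emb :: "('k::field, 'n::{finite,linorder}) mpoly \<Rightarrow> ('k, 'n) mpoly fract" where
  "emb p = Fract p 1"

text \<open>The localization of the polynomial ring at its prime ideal \<open>(x\<^sub>1, \<dots>, x\<^sub>d)\<close>, as a subring
  of the field of rational functions.\<close>

definition loc_ring :: "('k::field, 'n::{finite,linorder}) mpoly fract ring" where
  "loc_ring = ring_of_type_algebra
     \<lparr>carrier := {Fract f g | f g. g \<notin> Idl\<^bsub>ring_of_type_algebra\<^esub> (range poly_var)}\<rparr>"

definition loc_max :: "('k::field, 'n::{finite,linorder}) mpoly fract set" where
  "loc_max = Idl\<^bsub>loc_ring\<^esub> (range (\<lambda>j. emb (poly_var j)))"

definition monomial_ideal :: "('k::field, 'n::{finite,linorder}) mpoly fract set \<Rightarrow> bool" where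
  "monomial_ideal I \<longleftrightarrow> (\<exists>S. I = Idl\<^bsub>loc_ring\<^esub> ((\<lambda>v. emb (monomial v)) ` S))"

definition loc_mult :: "('k::field, 'n::{finite,linorder}) mpoly fract set \<Rightarrow> nat \<Rightarrow> nat" where
  "loc_mult I i = mult_seq CARD('n) loc_ring loc_max I i"

section \<open>Newton polyhedra\<close>

definition newton ::
    "('k::field, 'n::{finite,linorder}) mpoly fract set \<Rightarrow> (real^'n::{finite,linorder}) set" where
  "newton I = convex hull {\<chi> j. real (Poly_Mapping.lookup v j) | v. emb (monomial v) \<in> I}"

text \<open>A direction is recorded by its index \<open>j\<close>. A face \<open>F\<close> of a Newton polyhedron has
  exactly one decomposition as below, so the union is the index set of that decomposition.\<close>

definition unbounded_directions :: "(real^'n::finite) set \<Rightarrow> 'n set" where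
  "unbounded_directions F = \<Union>{U. F =
     {p + (\<Sum>j\<in>U. t j *\<^sub>R axis j 1) | p t.
        p \<in> convex hull {b. b extreme_point_of F} \<and> (\<forall>j\<in>U. 0 \<le> t j)}}"

definition bounded_faces :: "nat \<Rightarrow> (real^'n::finite) set \<Rightarrow> (real^'n) set set" where
  "bounded_faces k \<Gamma> = {G. G face_of \<Gamma> \<and> bounded G \<and> aff_dim G = int k}"

definition facets_F :: "(real^'n::finite) set \<Rightarrow> nat \<Rightarrow> (real^'n) set set" where
  "facets_F \<Gamma> k = {F. F face_of \<Gamma> \<and> aff_dim F = int CARD('n) - 1 \<and>
     card (unbounded_directions F) \<ge> CARD('n) - (k + 1) \<and>
     (\<exists>G \<in> bounded_faces k \<Gamma>. G \<subseteq> F)}"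

text \<open>The projection onto \<open>\<Sum>\<^bsub>j \<notin> M\<^esub> \<real>e\<^sub>j\<close>.\<close>

definition coord_proj :: "'n set \<Rightarrow> real^'n::finite \<Rightarrow> real^'n" where
  "coord_proj M x = (\<chi> j. if j \<in> M then 0 else x $ j)"

text \<open>The \<open>card J\<close>-dimensional Lebesgue measure of a subset of the coordinate subspace
  \<open>\<Sum>\<^bsub>j \<in> J\<^esub> \<real>e\<^sub>j\<close>.\<close>

definition coord_vol :: "'n set \<Rightarrow> (real^'n::finite) set \<Rightarrow> ennreal" where
  "coord_vol J S = emeasure (Pi\<^sub>M J (\<lambda>_. lborel)) ((\<lambda>x. restrict (\<lambda>j. x $ j) J) ` S)"

text \<open>\<open>Vol(G,F)\<close> for a \<open>k\<close>-dimensional \<open>G\<close>. There are finitely many \<open>M\<close>, so the infimum is a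
  minimum, except that the minimum over no \<open>M\<close> at all is \<open>\<infinity>\<close>.\<close>

definition Vol :: "nat \<Rightarrow> (real^'n::finite) set \<Rightarrow> (real^'n) set \<Rightarrow> ennreal" where
  "Vol k G F = of_nat (fact (k + 1)) *
     (INF M \<in> {M. M \<subseteq> unbounded_directions F \<and> card M = CARD('n) - (k + 1) \<and>
                  aff_dim (coord_proj M ` G) = int k}.
        coord_vol (- M) (convex hull (insert 0 (coord_proj M ` G))))"

text \<open>The formula conjectured by Achilles and Manaresi. The infimum ranges over a finite nonempty
  set of faces, so it is a minimum.\<close>

definition achilles_manaresi_formula ::
    "('k::field, 'n::{finite,linorder}) mpoly fract set \<Rightarrow> nat \<Rightarrow> bool" where
  "achilles_manaresi_formula I k \<longleftrightarrow>
     (of_nat (loc_mult I (CARD('n) - (k + 1))) :: ennreal) =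
     (\<Sum>F \<in> facets_F (newton I) k. INF G \<in> {G \<in> bounded_faces k (newton I). G \<subseteq> F}. Vol k G F)"

end

theory Submission
  imports Defs
begin

text \<open>The equality fails for \<open>k = 1\<close>: the multiplicity \<open>c\<^sub>1(I)\<close> is 6, while the right-hand side is
  at most 5.

  The Newton polyhedron of \<open>I = (x\<^sup>2z, y\<^sup>2z, xy)\<close> has the vertices \<open>A = (2,0,1)\<close>, \<open>B = (0,2,1)\<close>,
  \<open>C = (1,1,0)\<close> and exactly two bounded edges, \<open>AC\<close> and \<open>BC\<close>; the segment \<open>AB\<close> is not an edge,
  because its midpoint lies above \<open>C\<close>. Both edges lie on the vertical facet \<open>p + q = 2\<close>. Localized
  at the prime \<open>(x, y)\<close>, the ideal becomes \<open>(x, y)\<^sup>2\<close>, whose multiplicity 4 is twice the total area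
  of the two triangles spanned by \<open>0\<close> and the projections of the two edges. The conjectured formula
  takes the minimum over the two edges instead of their sum and therefore loses one of the triangles.
  The facets \<open>q + r = 1\<close> and \<open>p + r = 1\<close> contribute 1 each on both sides of the formula.

  The multiplicity is computed from its definition. All lengths involved are numbers of
  lattice points: the length of a quotient of two monomial ideals is the number of monomials that
  are lost (\<open>module_length_mon_ideal\<close>), because inserting these monomials one at a time gives a
  composition series (\<open>length_of_composition_series\<close>). The relation \<open>x\<^sup>2z \<cdot> y\<^sup>2z = (xy)\<^sup>2 z\<^sup>2\<close> makes
  the powers of \<open>I\<close> explicit: \<open>x\<^sup>py\<^sup>qz\<^sup>r \<in> I\<^sup>n\<close> iff \<open>p + q \<ge> 2n\<close>, \<open>q + r \<ge> n\<close> and \<open>p + r \<ge> n\<close>.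
  Counting the lattice points gives \<open>6nv + 5v - 1\<close> for the \<open>n\<close>-th summand, hence the Hilbert
  polynomial \<open>3u\<^sup>2v + 8uv + 5v - u - 1\<close>, and \<open>c\<^sub>1(I) = 2! \<cdot> 1! \<cdot> 3 = 6\<close>.

  For the right-hand side only an upper bound is needed. A facet that contributes has an
  unbounded direction and one of the edges \<open>AC\<close>, \<open>BC\<close>, and these two data determine its plane, which
  leaves the three facets above (\<open>facets_with_bounded_edge\<close>). Bounding the minimum by a
  single edge and the areas by simple regions gives \<open>3 + 1 + 1 = 5\<close>.\<close>

section \<open>Lengths and composition series\<close>

lemma (in cring) coset_eq_iff:
  assumes "ideal P R" "x \<in> carrier R" "y \<in> carrier R"
  shows "P +> x = P +> y \<longleftrightarrow> x \<ominus> y \<in> P"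
  using quotient_eq_iff_same_a_r_cos[OF assms] by blast

text \<open>The union in the definition of scalar multiplication on the quotient is over a family of equal cosets.\<close>

lemma (in cring) smult_quotient_module:
  assumes P: "ideal P R" and a: "a \<in> carrier R" and x: "x \<in> carrier R"
  shows "a \<odot>\<^bsub>quotient_module R N P\<^esub> (P +> x) = P +> (a \<otimes> x)"
proof -
  interpret P: ideal P R by fact
  have "P +> (a \<otimes> y) = P +> (a \<otimes> x)" if y: "y \<in> P +> x" for y
  proof -
    obtain p where p: "p \<in> P" "y = p \<oplus> x"
      using y by (auto simp: a_r_coset_def')
    have pc: "p \<in> carrier R" using p P.Icarr by blast
    then have "a \<otimes> (p \<oplus> x) \<ominus> a \<otimes> x = a \<otimes> p"
      using a x by algebra
    then have "a \<otimes> y \<ominus> a \<otimes> x \<in> P"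
      using P.I_l_closed[OF p(1) a] p(2) by simp
    then show ?thesis
      using coset_eq_iff[OF P] a x pc p(2) by simp
  qed
  moreover have "x \<in> P +> x"
    using P.a_rcos_self x by blast
  ultimately have "(\<Union>y\<in>P +> x. P +> (a \<otimes> y)) = P +> (a \<otimes> x)"
    by blast
  then show ?thesis
    by (simp add: quotient_module_def)
qed

lemma (in cring) submodule_quotient_module_image:
  assumes P: "ideal P R" and A: "ideal A R" and N: "ideal N R" and "P \<subseteq> A" "A \<subseteq> N"
  shows "submodule ((+>) P ` A) R (quotient_module R N P)"
proof -
  interpret P: ideal P R by fact
  interpret A: ideal A R by fact
  interpret N: ideal N R by fact
  let ?Q = "quotient_module R N P"
  have add: "(P +> x) <+> (P +> y) = P +> (x \<oplus> y)" if "x \<in> carrier R" "y \<in> carrier R" for x y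
    using P.a_rcos_sum that by blast
  have P0: "P = P +> \<zero>"
    using P.a_subset by simp
  have inverse: "inv\<^bsub>add_monoid ?Q\<^esub> (P +> x) = P +> (\<ominus> x)" if x: "x \<in> N" for x
    unfolding m_inv_def
  proof (rule the_equality, goal_cases)
    have xc: "x \<in> carrier R" using x N.Icarr by blast
    case 1
    have "P +> (x \<oplus> \<ominus> x) = P" "P +> (\<ominus> x \<oplus> x) = P"
      using xc P0 by (simp_all add: r_neg l_neg)
    then show ?case
      using x xc by (auto simp: quotient_module_def add)
    case (2 y)
    then obtain z where z: "z \<in> N" "y = P +> z" and "(P +> x) <+> (P +> z) = P"
      by (auto simp: quotient_module_def)
    moreover have zc: "z \<in> carrier R" using z N.Icarr by blast
    ultimately have "P +> (x \<oplus> z) = P +> \<zero>"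
      using add xc P0 by simp
    then have "x \<oplus> z \<ominus> \<zero> \<in> P"
      using coset_eq_iff[OF P] xc zc by simp
    moreover have "x \<oplus> z \<ominus> \<zero> = z \<ominus> (\<ominus> x)"
      using xc zc by algebra
    ultimately show ?case
      using coset_eq_iff[OF P, of z "\<ominus> x"] xc zc z(2) by simp
  qed
  show ?thesis
  proof (intro submodule.intro subgroup.intro submodule_axioms.intro)
    show "(+>) P ` A \<subseteq> carrier (add_monoid ?Q)"
      using \<open>A \<subseteq> N\<close> by (auto simp: quotient_module_def)
    show "\<one>\<^bsub>add_monoid ?Q\<^esub> \<in> (+>) P ` A"
      using P0 A.zero_closed by (auto simp: quotient_module_def)
    show "x \<otimes>\<^bsub>add_monoid ?Q\<^esub> y \<in> (+>) P ` A" if "x \<in> (+>) P ` A" "y \<in> (+>) P ` A" for x y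
      using that add A.Icarr by (auto simp: quotient_module_def)
    show "inv\<^bsub>add_monoid ?Q\<^esub> x \<in> (+>) P ` A" if "x \<in> (+>) P ` A" for x
      using that inverse \<open>A \<subseteq> N\<close> A.a_inv_closed by auto
    show "a \<odot>\<^bsub>?Q\<^esub> x \<in> (+>) P ` A" if "a \<in> carrier R" "x \<in> (+>) P ` A" for a x
      using that smult_quotient_module[OF P] A.I_l_closed A.Icarr by auto
  qed
qed

text \<open>Every element of \<open>M (Suc i) - M i\<close> generates \<open>M (Suc i)\<close> modulo \<open>M i\<close>, so the \<open>M i\<close>
  form a composition series. To bound an arbitrary chain of submodules, a submodule \<open>A\<close> is
  compared with the set of indices \<open>i\<close> for which \<open>A\<close> meets \<open>M (Suc i) - M i\<close>: this set
  determines \<open>A\<close> among all submodules containing or contained in \<open>A\<close>, so it grows strictly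
  along a strict chain, which therefore has at most \<open>n\<close> steps.\<close>

theorem (in cring) length_of_composition_series:
  assumes ideals: "\<And>i. i \<le> n \<Longrightarrow> ideal (M i) R"
    and strict: "\<And>i. i < n \<Longrightarrow> M i \<subset> M (Suc i)"
    and simple: "\<And>i a b. i < n \<Longrightarrow> a \<in> M (Suc i) - M i \<Longrightarrow> b \<in> M (Suc i) \<Longrightarrow>
      \<exists>r\<in>carrier R. b \<ominus> r \<otimes> a \<in> M i"
  shows "module_length R (quotient_module R (M n) (M 0)) = enat n"
proof -
  let ?Q = "quotient_module R (M n) (M 0)"
  define q where "q = (+>) (M 0)"
  interpret P: ideal "M 0" R by (rule ideals) simp
  interpret N: ideal "M n" R by (rule ideals) simp
  have mono: "M i \<subseteq> M j" if "i \<le> j" "j \<le> n" for i j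
    using that
  proof (induction j rule: dec_induct)
    case (step j)
    then show ?case using strict[of j] by simp
  qed simp
  have carr: "M i \<subseteq> carrier R" if "i \<le> n" for i
    using mono[OF that] N.a_subset by blast
  have upper: "m \<le> n"
    if sub: "\<forall>i\<le>m. submodule (C i) R ?Q" and chain: "\<forall>i<m. C i \<subset> C (Suc i)" for m C
  proof -
    define A where "A Y = {x \<in> M n. q x \<in> Y}" for Y
    define L where "L Y = {i. i < n \<and> A Y \<inter> (M (Suc i) - M i) \<noteq> {}}" for Y
    have L_mono: "L Y \<subseteq> L Z" if "Y \<subseteq> Z" for Y Z
      using that unfolding L_def A_def by blast
    have L_inj: "Y = Z"
      if Y: "submodule Y R ?Q" and Z: "submodule Z R ?Q" and le: "Y \<subseteq> Z" and eq: "L Y = L Z" for Y Z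
    proof -
      interpret Y: submodule Y R ?Q by fact
      interpret Z: submodule Z R ?Q by fact
      have add: "q (x \<oplus> y) \<in> W"
        if "submodule W R ?Q" "q x \<in> W" "q y \<in> W" "x \<in> M n" "y \<in> M n" for x y W
      proof -
        interpret W: submodule W R ?Q by fact
        show ?thesis
          using W.m_closed[OF that(2,3)] P.a_rcos_sum[of x y] that(4,5) N.Icarr
          by (simp add: q_def quotient_module_def)
      qed
      have smult: "q (r \<otimes> x) \<in> W"
        if "submodule W R ?Q" "q x \<in> W" "x \<in> M n" "r \<in> carrier R" for x r W
      proof -
        interpret W: submodule W R ?Q by fact
        show ?thesis
          using W.smult_closed[OF that(4,2)] smult_quotient_module[OF P.ideal_axioms that(4)]
            N.Icarr[OF that(3)] by (simp add: q_def)
      qed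
      have "A Z \<inter> M i \<subseteq> A Y" if "i \<le> n" for i
        using that
      proof (induction i)
        case 0
        have "q x = M 0" if "x \<in> M 0" for x
          using P.a_rcos_const[OF that] by (simp add: q_def)
        then show ?case
          using Y.one_closed mono[of 0 n] by (auto simp: A_def quotient_module_def)
      next
        case (Suc i)
        show ?case
        proof
          fix b assume b: "b \<in> A Z \<inter> M (Suc i)"
          show "b \<in> A Y"
          proof (cases "b \<in> M i")
            case True
            with b Suc show ?thesis by auto
          next
            case False
            with b Suc.prems have "i \<in> L Z" unfolding L_def by fastforce
            then have "i \<in> L Y" using eq by simp
            then obtain a where a: "a \<in> A Y" "a \<in> M (Suc i) - M i"
              unfolding L_def by blast
            obtain r where r: "r \<in> carrier R" "b \<ominus> r \<otimes> a \<in> M i"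
              using simple[of i a b] Suc.prems a b by auto
            have c: "a \<in> carrier R" "b \<in> carrier R"
              using a b N.Icarr by (auto simp: A_def)
            have e: "b \<ominus> r \<otimes> a = b \<oplus> (\<ominus> r) \<otimes> a" "b = (b \<ominus> r \<otimes> a) \<oplus> r \<otimes> a"
              using c r(1) by algebra+
            have aZ: "q a \<in> Z" and an: "a \<in> M n" and bn: "b \<in> M n" and bZ: "q b \<in> Z"
              and aY: "q a \<in> Y"
              using a b le by (auto simp: A_def)
            have "q (b \<ominus> r \<otimes> a) \<in> Z"
              unfolding e(1) by (intro add smult Z aZ bZ an bn N.I_l_closed) (use r in auto)
            then have "b \<ominus> r \<otimes> a \<in> A Y"
              using r Suc mono[of i n] by (auto simp: A_def)
            then have "q ((b \<ominus> r \<otimes> a) \<oplus> r \<otimes> a) \<in> Y"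
              by (intro add smult Y aY an N.I_l_closed r) (auto simp: A_def)
            then show ?thesis
              using e(2) bn by (simp add: A_def)
          qed
        qed
      qed
      from this[of n] have "A Z \<subseteq> A Y"
        by (auto simp: A_def)
      moreover have "Z \<subseteq> q ` M n"
        using Z.subset by (simp add: q_def quotient_module_def)
      ultimately have "Z \<subseteq> Y"
        by (auto simp: A_def)
      with le show ?thesis by simp
    qed
    have fin: "finite (L Y)" "card (L Y) \<le> n" for Y
      using card_mono[of "{..<n}" "L Y"] by (auto simp: L_def)
    have "i \<le> card (L (C i))" if "i \<le> m" for i
      using that
    proof (induction i)
      case (Suc i)
      have "C i \<subset> C (Suc i)" "submodule (C i) R ?Q" "submodule (C (Suc i)) R ?Q"
        using chain sub Suc.prems by auto
      then have "L (C i) \<subset> L (C (Suc i))"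
        using L_mono[of "C i" "C (Suc i)"] L_inj[of "C i" "C (Suc i)"] by blast
      then have "card (L (C i)) < card (L (C (Suc i)))"
        by (intro psubset_card_mono fin)
      with Suc show ?case by simp
    qed simp
    from this[of m] fin show ?thesis
      using le_trans by blast
  qed
  have "\<forall>i\<le>n. submodule (q ` M i) R ?Q"
    unfolding q_def using mono by (intro allI impI submodule_quotient_module_image ideals) auto
  moreover have "\<forall>i<n. q ` M i \<subset> q ` M (Suc i)"
  proof (intro allI impI)
    fix i assume i: "i < n"
    obtain x where x: "x \<in> M (Suc i)" "x \<notin> M i"
      using strict[OF i] by blast
    have "q x \<notin> q ` M i"
    proof
      assume "q x \<in> q ` M i"
      then obtain y where y: "y \<in> M i" "q x = q y" by blast
      interpret Mi: ideal "M i" R using ideals i by simp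
      have c: "x \<in> carrier R" "y \<in> carrier R"
        using x y carr[of "Suc i"] carr[of i] i by auto
      then have "x \<ominus> y \<in> M 0"
        using y(2) coset_eq_iff[OF P.ideal_axioms] by (simp add: q_def)
      then have "(x \<ominus> y) \<oplus> y \<in> M i"
        using mono[of 0 i] i y(1) by (intro Mi.a_closed) auto
      moreover have "(x \<ominus> y) \<oplus> y = x"
        using c by algebra
      ultimately show False using x by simp
    qed
    then show "q ` M i \<subset> q ` M (Suc i)"
      using x strict[OF i] by blast
  qed
  ultimately show ?thesis
    unfolding module_length_def
    by (intro antisym SUP_least SUP_upper) (auto dest: upper)
qed

section \<open>Monomial ideals of the local ring\<close>

lemma lookup_single_times_add:
  fixes g :: "('n \<Rightarrow>\<^sub>0 nat) \<Rightarrow>\<^sub>0 'k::field"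
  shows "Poly_Mapping.lookup (Poly_Mapping.single v c * g) (v + w) = c * Poly_Mapping.lookup g w"
  by (simp add: lookup_mult lookup_single when_mult)

lemma lookup_times_zero:
  fixes f g :: "('n \<Rightarrow>\<^sub>0 nat) \<Rightarrow>\<^sub>0 'k::field"
  shows "Poly_Mapping.lookup (f * g) 0 = Poly_Mapping.lookup f 0 * Poly_Mapping.lookup g 0"
proof -
  have "0 = l + q \<longleftrightarrow> q = 0 \<and> l = 0" for l q :: "'n \<Rightarrow>\<^sub>0 nat"
    by (auto simp: poly_mapping_eq_iff fun_eq_iff lookup_add)
  then have "(\<Sum>q. Poly_Mapping.lookup g q when 0 = l + q) = (Poly_Mapping.lookup g 0 when l = 0)" for l
    by (cases "l = 0") simp_all
  then show ?thesis
    by (simp add: lookup_mult mult_when)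
qed

lemma keys_times_subset:
  fixes f g :: "('n \<Rightarrow>\<^sub>0 nat) \<Rightarrow>\<^sub>0 'k::field"
  assumes "Poly_Mapping.keys f \<subseteq> S" "Poly_Mapping.keys g \<subseteq> T"
  shows "Poly_Mapping.keys (f * g) \<subseteq> {s + t | s t. s \<in> S \<and> t \<in> T}"
  using keys_mult[of f g] assms by blast

text \<open>The exponent sets of monomial ideals.\<close>

definition upset :: "('n \<Rightarrow>\<^sub>0 nat) set \<Rightarrow> bool" where
  "upset S \<longleftrightarrow> (\<forall>s\<in>S. \<forall>t. s + t \<in> S)"

text \<open>The ideal of the local ring generated by the monomials with exponents in an \<open>upset\<close> \<open>S\<close>. Writing it
  by fractions with numerator supported in \<open>S\<close> reduces ideal operations to operations on exponents.\<close>

definition mon_ideal ::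
    "('n::{finite,linorder} \<Rightarrow>\<^sub>0 nat) set \<Rightarrow> ('k::field, 'n) mpoly fract set" where
  "mon_ideal S = {Fract f g | f g. Poly_Mapping.keys f \<subseteq> S \<and> Poly_Mapping.lookup g 0 \<noteq> 0}"

lemma mon_idealI:
  "Poly_Mapping.keys f \<subseteq> S \<Longrightarrow> Poly_Mapping.lookup g 0 \<noteq> 0 \<Longrightarrow> Fract f g \<in> mon_ideal S"
  unfolding mon_ideal_def by blast

lemma mon_idealE:
  assumes "x \<in> mon_ideal S"
  obtains f g where "x = Fract f g" "Poly_Mapping.keys f \<subseteq> S" "Poly_Mapping.lookup g 0 \<noteq> 0" "g \<noteq> 0"
  using assms unfolding mon_ideal_def by force

lemma upset_Un: "upset S \<Longrightarrow> upset T \<Longrightarrow> upset (S \<union> T)"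
  by (auto simp: upset_def)

lemma keys_times_upset:
  fixes f g :: "('n \<Rightarrow>\<^sub>0 nat) \<Rightarrow>\<^sub>0 'k::field"
  assumes "upset S" "Poly_Mapping.keys f \<subseteq> S"
  shows "Poly_Mapping.keys (f * g) \<subseteq> S" "Poly_Mapping.keys (g * f) \<subseteq> S"
  using keys_times_subset[OF assms(2) subset_UNIV, of g] assms(1)
  by (force simp: upset_def mult.commute[of g f])+

lemma mon_ideal_add:
  assumes "upset S" "x \<in> mon_ideal S" "y \<in> mon_ideal S"
  shows "x + y \<in> mon_ideal S"
proof -
  obtain f g where x: "x = Fract f g" "Poly_Mapping.keys f \<subseteq> S" "Poly_Mapping.lookup g 0 \<noteq> 0" "g \<noteq> 0"
    using assms(2) by (rule mon_idealE)
  obtain h k where y: "y = Fract h k" "Poly_Mapping.keys h \<subseteq> S" "Poly_Mapping.lookup k 0 \<noteq> 0" "k \<noteq> 0"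
    using assms(3) by (rule mon_idealE)
  have "Poly_Mapping.keys (f * k + h * g) \<subseteq> S"
    using keys_add[of "f * k" "h * g"] keys_times_upset[OF assms(1)] x(2) y(2) by blast
  then show ?thesis
    using x y by (auto simp: lookup_times_zero intro!: mon_idealI)
qed

lemma mon_ideal_mult:
  assumes "upset S" "x \<in> mon_ideal S" "y \<in> mon_ideal UNIV"
  shows "x * y \<in> mon_ideal S" "y * x \<in> mon_ideal S"
proof -
  obtain f g where x: "x = Fract f g" "Poly_Mapping.keys f \<subseteq> S" "Poly_Mapping.lookup g 0 \<noteq> 0" "g \<noteq> 0"
    using assms(2) by (rule mon_idealE)
  obtain h k where y: "y = Fract h k" "Poly_Mapping.lookup k 0 \<noteq> 0" "k \<noteq> 0"
    using assms(3) by (rule mon_idealE)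
  show "x * y \<in> mon_ideal S"
    using x y keys_times_upset[OF assms(1) x(2)] by (auto simp: lookup_times_zero intro!: mon_idealI)
  then show "y * x \<in> mon_ideal S"
    by (simp add: mult.commute)
qed

lemma mon_ideal_uminus: "x \<in> mon_ideal S \<Longrightarrow> - x \<in> mon_ideal S"
  by (elim mon_idealE) (auto intro!: mon_idealI)

lemma zero_in_mon_ideal: "0 \<in> mon_ideal S"
  by (auto simp: Zero_fract_def intro!: mon_idealI)

lemma one_in_mon_ideal: "1 \<in> mon_ideal UNIV"
  by (auto simp: One_fract_def intro!: mon_idealI)

text \<open>If \<open>x\<^sup>v = f / g\<close>, then the term of \<open>f = x\<^sup>v g\<close> at \<open>v\<close> is the nonzero constant term of \<open>g\<close>, so \<open>v\<close> is
  one of the exponents of \<open>f\<close>.\<close>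

lemma emb_monomial_in_mon_ideal_iff:
  assumes "upset S"
  shows "emb (monomial v) \<in> (mon_ideal S :: ('k::field, 'n::{finite,linorder}) mpoly fract set) \<longleftrightarrow> v \<in> S"
proof
  assume "emb (monomial v) \<in> (mon_ideal S :: ('k, 'n) mpoly fract set)"
  then obtain f g :: "('k, 'n) mpoly" where fg: "emb (monomial v) = Fract f g"
    "Poly_Mapping.keys f \<subseteq> S" "Poly_Mapping.lookup g 0 \<noteq> 0" "g \<noteq> 0"
    by (rule mon_idealE)
  have "monomial v * g = f"
    using fg(1,4) by (simp add: emb_def eq_fract)
  then have "Poly_Mapping.lookup f v = Poly_Mapping.lookup g 0"
    using lookup_single_times_add[of v 1 g 0] by (simp add: monomial_def)
  then show "v \<in> S"
    using fg(2,3) by (auto simp: in_keys_iff)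
next
  assume "v \<in> S"
  then show "emb (monomial v) \<in> (mon_ideal S :: ('k, 'n) mpoly fract set)"
    unfolding emb_def by (intro mon_idealI) (auto simp: monomial_def)
qed

lemma emb_monomial_add: "emb (monomial (v + w)) = emb (monomial v) * emb (monomial w)"
  by (simp add: emb_def monomial_def mult_single)

lemma ring_of_type_algebra_simps [simp]:
  "carrier ring_of_type_algebra = UNIV"
  "x \<otimes>\<^bsub>ring_of_type_algebra\<^esub> y = x * y"
  "x \<oplus>\<^bsub>ring_of_type_algebra\<^esub> y = x + y"
  "\<zero>\<^bsub>ring_of_type_algebra\<^esub> = 0"
  "\<one>\<^bsub>ring_of_type_algebra\<^esub> = 1"
  by (simp_all add: ring_of_type_algebra_def)

lemma poly_mapping_eq_sum_single:
  fixes f :: "'a \<Rightarrow>\<^sub>0 'b::comm_monoid_add"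
  shows "f = (\<Sum>k\<in>Poly_Mapping.keys f. Poly_Mapping.single k (Poly_Mapping.lookup f k))"
proof (rule poly_mapping_eqI)
  fix k
  show "Poly_Mapping.lookup f k =
    Poly_Mapping.lookup (\<Sum>k\<in>Poly_Mapping.keys f. Poly_Mapping.single k (Poly_Mapping.lookup f k)) k"
    by (cases "k \<in> Poly_Mapping.keys f")
      (auto simp: lookup_sum lookup_single when_def not_in_keys_iff_lookup_eq_zero)
qed

lemma split_off_variable:
  fixes v :: "'n \<Rightarrow>\<^sub>0 nat"
  assumes "v \<noteq> 0"
  obtains j w where "v = Poly_Mapping.single j 1 + w"
proof -
  obtain j where j: "Poly_Mapping.lookup v j \<noteq> 0"
    using assms by (auto simp: poly_mapping_eq_iff fun_eq_iff)
  have "v = Poly_Mapping.single j 1 + (v - Poly_Mapping.single j 1)"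
    using j by (intro poly_mapping_eqI) (auto simp: lookup_add lookup_minus lookup_single when_def)
  then show ?thesis by (rule that)
qed

text \<open>The denominators allowed in the local ring are the polynomials with nonzero constant term.\<close>

lemma in_Idl_poly_var_iff:
  fixes g :: "('k::field, 'n::{finite,linorder}) mpoly"
  shows "g \<in> Idl\<^bsub>ring_of_type_algebra\<^esub> (range poly_var) \<longleftrightarrow> Poly_Mapping.lookup g 0 = 0"
proof -
  let ?R = "ring_of_type_algebra :: ('k, 'n) mpoly ring"
  interpret cring ?R by (rule cring_from_type_algebra)
  let ?J = "{g :: ('k, 'n) mpoly. Poly_Mapping.lookup g 0 = 0}"
  have minus: "\<ominus>\<^bsub>?R\<^esub> x = - x" for x
    by (rule minus_equality) auto
  have "ideal ?J ?R"
  proof (rule idealI)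
    show "subgroup ?J (add_monoid ?R)"
      by (rule add.subgroupI)
        (use minus in \<open>auto simp: lookup_add a_inv_def[symmetric] intro!: exI[of _ 0]\<close>)
  qed (auto simp: ring_axioms lookup_times_zero)
  moreover have "range poly_var \<subseteq> ?J"
  proof -
    have "Poly_Mapping.single j (1 :: nat) \<noteq> 0" for j :: 'n
      by (metis lookup_single_eq lookup_zero one_neq_zero)
    then show ?thesis
      by (auto simp: poly_var_def monomial_def lookup_single when_def)
  qed
  ultimately have "Idl\<^bsub>?R\<^esub> (range poly_var) \<subseteq> ?J"
    by (rule genideal_minimal)
  moreover have "g \<in> Idl\<^bsub>?R\<^esub> (range poly_var)" if "Poly_Mapping.lookup g 0 = 0"
  proof -
    interpret I: ideal "Idl\<^bsub>?R\<^esub> (range poly_var)" ?R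
      by (rule genideal_ideal) simp
    have var: "poly_var j \<in> Idl\<^bsub>?R\<^esub> (range poly_var)" for j :: 'n
      using genideal_self[of "range poly_var"] by auto
    have mon: "Poly_Mapping.single k c \<in> Idl\<^bsub>?R\<^esub> (range poly_var)" if k: "k \<noteq> 0" for k :: "'n \<Rightarrow>\<^sub>0 nat" and c :: 'k
    proof -
      obtain j w where "k = Poly_Mapping.single j 1 + w"
        using k by (rule split_off_variable)
      then have "Poly_Mapping.single k c = poly_var j * Poly_Mapping.single w c"
        by (simp add: poly_var_def monomial_def mult_single)
      then show ?thesis
        using I.I_r_closed[OF var, of "Poly_Mapping.single w c" j] by simp
    qed
    have "(\<Sum>k\<in>K. Poly_Mapping.single k (Poly_Mapping.lookup g k)) \<in> Idl\<^bsub>?R\<^esub> (range poly_var)"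
      if "finite K" "0 \<notin> K" for K
      using that
    proof (induction K)
      case empty
      then show ?case using I.zero_closed by simp
    next
      case (insert k K)
      then show ?case using I.a_closed[OF mon[of k]] by auto
    qed
    from this[of "Poly_Mapping.keys g"] show ?thesis
      using that poly_mapping_eq_sum_single[of g] by (simp add: in_keys_iff)
  qed
  ultimately show ?thesis by blast
qed

lemma loc_ring_simps [simp]:
  "carrier loc_ring = mon_ideal UNIV"
  "x \<otimes>\<^bsub>loc_ring\<^esub> y = x * y"
  "x \<oplus>\<^bsub>loc_ring\<^esub> y = x + y"
  "\<zero>\<^bsub>loc_ring\<^esub> = 0"
  "\<one>\<^bsub>loc_ring\<^esub> = 1"
  unfolding loc_ring_def
  by (simp_all add: in_Idl_poly_var_iff mon_ideal_def)

lemma upset_UNIV: "upset UNIV"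
  by (simp add: upset_def)

lemma cring_loc_ring: "cring loc_ring"
proof (rule cringI)
  show "abelian_group loc_ring"
    by (rule abelian_groupI)
      (auto simp: mon_ideal_add upset_UNIV zero_in_mon_ideal algebra_simps
        intro!: bexI[OF _ mon_ideal_uminus])
  show "Group.comm_monoid loc_ring"
    by (rule comm_monoidI) (auto simp: mon_ideal_mult upset_UNIV one_in_mon_ideal)
qed (auto simp: algebra_simps)

interpretation loc: cring loc_ring
  by (rule cring_loc_ring)

lemma loc_ring_uminus: "x \<in> mon_ideal UNIV \<Longrightarrow> \<ominus>\<^bsub>loc_ring\<^esub> x = - x"
  by (rule loc.minus_equality) (auto intro: mon_ideal_uminus)

lemma mon_ideal_mono: "S \<subseteq> T \<Longrightarrow> mon_ideal S \<subseteq> mon_ideal T"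
  unfolding mon_ideal_def by blast

lemma ideal_mon_ideal:
  assumes "upset S"
  shows "ideal (mon_ideal S :: ('k::field, 'n::{finite,linorder}) mpoly fract set) loc_ring"
proof (rule idealI)
  show "subgroup (mon_ideal S :: ('k, 'n) mpoly fract set) (add_monoid loc_ring)"
  proof (rule loc.add.subgroupI)
    show "\<ominus>\<^bsub>loc_ring\<^esub> a \<in> mon_ideal S" if "a \<in> mon_ideal S" for a :: "('k, 'n) mpoly fract"
      using mon_ideal_uminus[OF that] loc_ring_uminus[of a] mon_ideal_mono[of S UNIV] that
      by auto
    show "mon_ideal S \<subseteq> carrier loc_ring"
      using mon_ideal_mono[of S UNIV] by simp
    show "mon_ideal S \<noteq> {}"
      using zero_in_mon_ideal[of S] by blast
  qed (simp add: mon_ideal_add[OF assms])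
qed (auto simp: loc.ring_axioms mon_ideal_mult[OF assms])

text \<open>A fraction \<open>f / g\<close> is the sum of its terms, each a unit multiple of a monomial.\<close>

lemma mon_ideal_subset_ideal:
  fixes J :: "('k::field, 'n::{finite,linorder}) mpoly fract set"
  assumes J: "ideal J loc_ring" and mon: "\<And>v. v \<in> S \<Longrightarrow> emb (monomial v) \<in> J"
  shows "mon_ideal S \<subseteq> J"
proof
  interpret J: ideal J loc_ring by fact
  fix x :: "('k, 'n) mpoly fract"
  assume "x \<in> mon_ideal S"
  then obtain f g where x: "x = Fract f g" "Poly_Mapping.keys f \<subseteq> S"
    "Poly_Mapping.lookup g 0 \<noteq> 0" "g \<noteq> 0"
    by (rule mon_idealE)
  have "Fract (\<Sum>k\<in>K. Poly_Mapping.single k (Poly_Mapping.lookup f k)) g \<in> J"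
    if "finite K" "K \<subseteq> S" for K
    using that
  proof (induction K)
    case empty
    then show ?case using J.zero_closed by (simp add: fract_collapse)
  next
    case (insert k K)
    let ?t = "\<lambda>k. Poly_Mapping.single k (Poly_Mapping.lookup f k)"
    have "Fract (Poly_Mapping.single 0 (Poly_Mapping.lookup f k)) g * emb (monomial k) \<in> J"
      using J.I_l_closed[OF mon[of k]] insert.prems x(3) by (auto intro: mon_idealI)
    moreover have "Fract (Poly_Mapping.single 0 (Poly_Mapping.lookup f k)) g * emb (monomial k) = Fract (?t k) g"
      by (simp add: emb_def monomial_def mult_single)
    moreover have "Fract (?t k + sum ?t K) g = Fract (?t k) g + Fract (sum ?t K) g"
      using x(4) by (simp add: eq_fract algebra_simps)
    ultimately show ?case
      using insert J.a_closed by auto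
  qed
  from this[of "Poly_Mapping.keys f"] show "x \<in> J"
    using x poly_mapping_eq_sum_single[of f] by simp
qed

lemma Idl_monomials:
  assumes "upset S" "G \<subseteq> S" "\<And>v. v \<in> S \<Longrightarrow> \<exists>s\<in>G. \<exists>t. v = s + t"
  shows "Idl\<^bsub>loc_ring\<^esub> ((\<lambda>v. emb (monomial v)) ` G) = mon_ideal S"
proof
  let ?E = "(\<lambda>v. emb (monomial v)) ` G"
  have E: "?E \<subseteq> carrier loc_ring"
    using emb_monomial_in_mon_ideal_iff[OF upset_UNIV] by auto
  show "Idl\<^bsub>loc_ring\<^esub> ?E \<subseteq> mon_ideal S"
    by (intro loc.genideal_minimal ideal_mon_ideal assms)
      (use assms emb_monomial_in_mon_ideal_iff in blast)
  interpret I: ideal "Idl\<^bsub>loc_ring\<^esub> ?E" loc_ring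
    by (rule loc.genideal_ideal[OF E])
  show "mon_ideal S \<subseteq> Idl\<^bsub>loc_ring\<^esub> ?E"
  proof (rule mon_ideal_subset_ideal[OF I.ideal_axioms])
    fix v assume "v \<in> S"
    then obtain s t where st: "s \<in> G" "v = s + t" using assms(3) by blast
    have "emb (monomial s) * emb (monomial t) \<in> Idl\<^bsub>loc_ring\<^esub> ?E"
      using I.I_r_closed[of "emb (monomial s)" "emb (monomial t)"] loc.genideal_self[OF E] st
        emb_monomial_in_mon_ideal_iff[OF upset_UNIV, of t] by auto
    then show "emb (monomial v) \<in> Idl\<^bsub>loc_ring\<^esub> ?E"
      by (simp add: st emb_monomial_add)
  qed
qed

lemma ideal_prod_mon_ideal:
  assumes S: "upset S" and T: "upset T"
  shows "ideal_prod loc_ring (mon_ideal S) (mon_ideal T) =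
    (mon_ideal {s + t | s t. s \<in> S \<and> t \<in> T} :: ('k::field, 'n::{finite,linorder}) mpoly fract set)"
    (is "?P = mon_ideal ?ST")
proof
  have ST: "upset ?ST"
    unfolding upset_def
  proof (intro ballI allI)
    fix x u assume "x \<in> ?ST"
    then obtain s t where st: "x = s + t" "s \<in> S" "t \<in> T" by blast
    then have "x + u = s + (t + u)" "t + u \<in> T"
      using T by (auto simp: upset_def add.assoc)
    with st show "x + u \<in> ?ST" by blast
  qed
  show "?P \<subseteq> mon_ideal ?ST"
  proof
    fix x assume "x \<in> ?P"
    then show "x \<in> mon_ideal ?ST"
    proof (induction rule: ideal_prod.induct)
      case (prod a b)
      obtain f g where a: "a = Fract f g" "Poly_Mapping.keys f \<subseteq> S"
        "Poly_Mapping.lookup g 0 \<noteq> 0"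
        using prod(1) by (rule mon_idealE)
      obtain h k where b: "b = Fract h k" "Poly_Mapping.keys h \<subseteq> T"
        "Poly_Mapping.lookup k 0 \<noteq> 0"
        using prod(2) by (rule mon_idealE)
      show ?case
        using a b keys_times_subset[OF a(2) b(2)]
        by (auto simp: lookup_times_zero intro!: mon_idealI)
    next
      case (sum x y)
      then show ?case using mon_ideal_add[OF ST] by simp
    qed
  qed
  show "mon_ideal ?ST \<subseteq> ?P"
  proof (rule mon_ideal_subset_ideal)
    show "ideal ?P loc_ring"
      by (intro loc.ideal_prod_is_ideal ideal_mon_ideal S T)
    fix v assume "v \<in> ?ST"
    then obtain s t where "v = s + t" "s \<in> S" "t \<in> T" by blast
    then show "emb (monomial v) \<in> ?P"
      using ideal_prod.prod[of "emb (monomial s) :: ('k, 'n) mpoly fract" "mon_ideal S"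
          "emb (monomial t)" "mon_ideal T" loc_ring]
      by (simp add: emb_monomial_add emb_monomial_in_mon_ideal_iff S T)
  qed
qed

lemma set_add_mon_ideal:
  assumes S: "upset S" and T: "upset T"
  shows "mon_ideal S <+>\<^bsub>loc_ring\<^esub> mon_ideal T = mon_ideal (S \<union> T)"
proof
  show "mon_ideal S <+>\<^bsub>loc_ring\<^esub> mon_ideal T \<subseteq> mon_ideal (S \<union> T)"
    using mon_ideal_mono[of S "S \<union> T"] mon_ideal_mono[of T "S \<union> T"]
      mon_ideal_add[OF upset_Un[OF S T]]
    by (auto simp: set_add_def' subset_iff)
  have I: "ideal (mon_ideal S <+>\<^bsub>loc_ring\<^esub> mon_ideal T) loc_ring"
    by (intro loc.add_ideals ideal_mon_ideal S T)
  show "mon_ideal (S \<union> T) \<subseteq> mon_ideal S <+>\<^bsub>loc_ring\<^esub> mon_ideal T"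
  proof (rule mon_ideal_subset_ideal[OF I])
    fix v assume "v \<in> S \<union> T"
    moreover have "x \<in> mon_ideal S <+>\<^bsub>loc_ring\<^esub> mon_ideal T"
      if "x \<in> mon_ideal S \<or> x \<in> mon_ideal T" for x
      using that zero_in_mon_ideal[of S] zero_in_mon_ideal[of T] unfolding set_add_def' by force
    ultimately show "emb (monomial v) \<in> mon_ideal S <+>\<^bsub>loc_ring\<^esub> mon_ideal T"
      using emb_monomial_in_mon_ideal_iff[OF S] emb_monomial_in_mon_ideal_iff[OF T] by blast
  qed
qed


section \<open>Lengths of quotients of monomial ideals\<close>

definition total_deg :: "('n::finite \<Rightarrow>\<^sub>0 nat) \<Rightarrow> nat" where
  "total_deg v = (\<Sum>j\<in>UNIV. Poly_Mapping.lookup v j)"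

lemma total_deg_add: "total_deg (v + w) = total_deg v + total_deg w"
  by (simp add: total_deg_def lookup_add sum.distrib)

lemma total_deg_eq_0_iff: "total_deg v = 0 \<longleftrightarrow> v = 0"
  by (auto simp: total_deg_def poly_mapping_eq_iff fun_eq_iff)

lemma total_deg_single: "total_deg (Poly_Mapping.single j n) = n"
  by (simp add: total_deg_def lookup_single when_def)

lemma upset_total_deg: "upset {v. n \<le> total_deg v}"
  by (auto simp: upset_def total_deg_add)

lemma ideal_power_loc_max:
  "ideal_power loc_ring loc_max n = (mon_ideal {v. n \<le> total_deg v} :: ('k::field, 'n::{finite,linorder}) mpoly fract set)"
proof (induction n)
  case (Suc n)
  have "loc_max = (mon_ideal {v. 1 \<le> total_deg v} :: ('k, 'n) mpoly fract set)"
  proof -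
    have "range (\<lambda>j. emb (poly_var j :: ('k, 'n) mpoly)) = (\<lambda>v. emb (monomial v)) ` range (\<lambda>j. Poly_Mapping.single j 1)"
      by (auto simp: poly_var_def)
    moreover have "Idl\<^bsub>loc_ring\<^esub> ((\<lambda>v. emb (monomial v :: ('k, 'n) mpoly)) ` range (\<lambda>j. Poly_Mapping.single j 1)) =
        mon_ideal {v. 1 \<le> total_deg v}"
    proof (rule Idl_monomials[OF upset_total_deg])
      fix v :: "'n \<Rightarrow>\<^sub>0 nat"
      assume "v \<in> {v. 1 \<le> total_deg v}"
      then have "v \<noteq> 0" using total_deg_eq_0_iff[of v] by auto
      then show "\<exists>s\<in>range (\<lambda>j. Poly_Mapping.single j 1). \<exists>t. v = s + t"
        by (rule split_off_variable) blast
    qed (auto simp: total_deg_single)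
    ultimately show ?thesis
      unfolding loc_max_def by metis
  qed
  note max = this
  have prod: "{s + t | s t. s \<in> {v. 1 \<le> total_deg v} \<and> t \<in> {v. n \<le> total_deg v}} = {v :: 'n \<Rightarrow>\<^sub>0 nat. Suc n \<le> total_deg v}"
    (is "?L = ?R")
  proof
    show "?L \<subseteq> ?R" by (auto simp: total_deg_add)
    show "?R \<subseteq> ?L"
    proof
      fix v :: "'n \<Rightarrow>\<^sub>0 nat" assume v: "v \<in> ?R"
      then have "v \<noteq> 0" using total_deg_eq_0_iff[of v] by auto
      then obtain j w where jw: "v = Poly_Mapping.single j 1 + w"
        by (rule split_off_variable)
      show "v \<in> ?L"
      proof -
        have "1 \<le> total_deg (Poly_Mapping.single j 1)" "n \<le> total_deg w"
          using v by (simp_all add: jw total_deg_add total_deg_single)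
        then show ?thesis using jw by blast
      qed
    qed
  qed
  show ?case
    unfolding ideal_power.simps Suc.IH unfolding max ideal_prod_mon_ideal[OF upset_total_deg upset_total_deg] prod ..
qed simp

text \<open>Adding a largest missing exponent keeps the set closed, so \<open>P\<close> can be enlarged to \<open>N\<close> one
  exponent at a time.\<close>

lemma upset_chain:
  fixes P N :: "('n::finite \<Rightarrow>\<^sub>0 nat) set"
  assumes "upset P" "upset N" "P \<subseteq> N" "finite (N - P)"
  shows "\<exists>M. M 0 = P \<and> M (card (N - P)) = N \<and> (\<forall>i\<le>card (N - P). upset (M i)) \<and>
    (\<forall>i<card (N - P). \<exists>e. e \<notin> M i \<and> M (Suc i) = insert e (M i))"
  using assms
proof (induction "card (N - P)" arbitrary: P)
  case 0
  then have "P = N" by auto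
  with 0 show ?case by (intro exI[of _ "\<lambda>_. P"]) auto
next
  case (Suc n)
  then have ne: "N - P \<noteq> {}" by auto
  have "Max (total_deg ` (N - P)) \<in> total_deg ` (N - P)"
    using Suc.prems(4) ne by (intro Max_in) auto
  then obtain e where e: "e \<in> N - P" and "total_deg e = Max (total_deg ` (N - P))"
    by (metis imageE)
  then have max: "total_deg w \<le> total_deg e" if "w \<in> N - P" for w
    using that Suc.prems(4) by simp
  have up: "upset (insert e P)"
    unfolding upset_def
  proof (intro ballI allI)
    fix s t assume s: "s \<in> insert e P"
    show "s + t \<in> insert e P"
    proof (cases "s \<in> P \<or> t = 0")
      case True
      then show ?thesis using s \<open>upset P\<close> by (auto simp: upset_def)
    next
      case False
      then have "s = e" "0 < total_deg t" using s total_deg_eq_0_iff[of t] by auto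
      then have "s + t \<notin> N - P" using max[of "s + t"] by (auto simp: total_deg_add)
      moreover have "s + t \<in> N" using \<open>upset N\<close> e \<open>s = e\<close> by (auto simp: upset_def)
      ultimately show ?thesis by blast
    qed
  qed
  have N: "N - P = insert e (N - insert e P)" using e by blast
  have fin: "finite (N - insert e P)" using Suc.prems(4) by (rule finite_subset[rotated]) blast
  have card: "card (N - P) = Suc (card (N - insert e P))"
    by (subst N, subst card_insert_disjoint[OF fin]) auto
  then have "n = card (N - insert e P)" using Suc.hyps(2) by simp
  from Suc.hyps(1)[OF this up \<open>upset N\<close> _ fin] e Suc.prems(3)
  obtain M where M: "M 0 = insert e P" "M (card (N - insert e P)) = N"
    "\<And>i. i\<le>card (N - insert e P) \<Longrightarrow> upset (M i)"
    "\<And>i. i<card (N - insert e P) \<Longrightarrow> \<exists>e. e \<notin> M i \<and> M (Suc i) = insert e (M i)"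
    by auto
  show ?case
    unfolding card
    by (rule exI[of _ "\<lambda>i. case i of 0 \<Rightarrow> P | Suc i \<Rightarrow> M i"])
      (use M e \<open>upset P\<close> in \<open>auto split: nat.splits\<close>)
qed

text \<open>The chain above gives a composition series. Its steps are simple: if the numerator of a fraction
  involves the new exponent \<open>e\<close>, then a suitable multiple of it cancels the term at \<open>e\<close> of any other
  fraction.\<close>

theorem module_length_mon_ideal:
  assumes P: "upset P" and N: "upset N" and sub: "P \<subseteq> N" and fin: "finite (N - P)"
  shows "module_length loc_ring (quotient_module loc_ring
      (mon_ideal N :: ('k::field, 'n::{finite,linorder}) mpoly fract set) (mon_ideal P)) =
    enat (card (N - P))"
proof -
  obtain M where M: "M 0 = P" "M (card (N - P)) = N" "\<And>i. i\<le>card (N - P) \<Longrightarrow> upset (M i)"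
    "\<And>i. i<card (N - P) \<Longrightarrow> \<exists>e. e \<notin> M i \<and> M (Suc i) = insert e (M i)"
    using upset_chain[OF assms] by blast
  define I where "I i = (mon_ideal (M i) :: ('k, 'n) mpoly fract set)" for i
  have "module_length loc_ring (quotient_module loc_ring (I (card (N - P))) (I 0)) = enat (card (N - P))"
  proof (rule loc.length_of_composition_series)
    show "ideal (I i) loc_ring" if "i \<le> card (N - P)" for i
      unfolding I_def by (intro ideal_mon_ideal M that)
    fix i assume i: "i < card (N - P)"
    obtain e where e: "e \<notin> M i" "M (Suc i) = insert e (M i)" using M(4)[OF i] by blast
    have up: "upset (M i)" "upset (M (Suc i))" using M(3) i by auto
    have "emb (monomial e) \<in> I (Suc i) - I i"
      using e emb_monomial_in_mon_ideal_iff[OF up(1)] emb_monomial_in_mon_ideal_iff[OF up(2)]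
      by (auto simp: I_def)
    moreover have "I i \<subseteq> I (Suc i)"
      unfolding I_def using e by (intro mon_ideal_mono) auto
    ultimately show "I i \<subset> I (Suc i)" by blast
    fix a b assume "a \<in> I (Suc i) - I i" and b: "b \<in> I (Suc i)"
    then have a: "a \<in> I (Suc i)" "a \<notin> I i" by auto
    obtain f g where fg: "a = Fract f g" "Poly_Mapping.keys f \<subseteq> M (Suc i)"
      "Poly_Mapping.lookup g 0 \<noteq> 0" "g \<noteq> 0"
      using a(1) unfolding I_def by (rule mon_idealE)
    obtain h k where hk: "b = Fract h k" "Poly_Mapping.keys h \<subseteq> M (Suc i)"
      "Poly_Mapping.lookup k 0 \<noteq> 0" "k \<noteq> 0"
      using b unfolding I_def by (rule mon_idealE)
    have fe: "Poly_Mapping.lookup f e \<noteq> 0"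
    proof
      assume "Poly_Mapping.lookup f e = 0"
      then have "Poly_Mapping.keys f \<subseteq> M i" using fg(2) e by (auto simp: in_keys_iff)
      then show False using a(2) fg mon_idealI unfolding I_def by blast
    qed
    define c where "c = Poly_Mapping.lookup h e / Poly_Mapping.lookup f e"
    \<comment> \<open>The multiplier cancels the term of \<open>b\<close> at the new exponent \<open>e\<close>.\<close>
    let ?c = "Poly_Mapping.single 0 c :: ('k, 'n) mpoly"
    define r where "r = Fract (?c * g) k"
    have r: "r \<in> mon_ideal UNIV"
      unfolding r_def using hk by (intro mon_idealI) auto
    have "b - r * a = Fract (h - ?c * f) k"
      using fg(4) hk(4) by (simp add: r_def fg(1) hk(1) eq_fract algebra_simps)
    moreover have "Poly_Mapping.keys (h - ?c * f) \<subseteq> M i"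
    proof
      fix w assume w: "w \<in> Poly_Mapping.keys (h - ?c * f)"
      have l: "Poly_Mapping.lookup (?c * f) w = c * Poly_Mapping.lookup f w" for w
        using lookup_single_times_add[of 0 c f w] by simp
      have "c * Poly_Mapping.lookup f e = Poly_Mapping.lookup h e"
        using fe by (simp add: c_def)
      then have "w \<noteq> e"
        using w by (auto simp: in_keys_iff lookup_minus l)
      moreover have "w \<in> M (Suc i)"
        using w fg(2) hk(2)
        by (cases "Poly_Mapping.lookup f w = 0") (auto simp: in_keys_iff lookup_minus l subset_iff)
      ultimately show "w \<in> M i" using e by simp
    qed
    ultimately have "b - r * a \<in> I i"
      unfolding I_def using hk by (auto intro: mon_idealI)
    moreover have "r * a \<in> mon_ideal UNIV"
      using mon_ideal_mult[OF upset_UNIV r] a(1) mon_ideal_mono[of "M (Suc i)" UNIV] by (auto simp: I_def)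
    ultimately have "b \<ominus>\<^bsub>loc_ring\<^esub> r \<otimes>\<^bsub>loc_ring\<^esub> a \<in> I i"
      by (simp add: a_minus_def loc_ring_uminus)
    then show "\<exists>r\<in>carrier loc_ring. b \<ominus>\<^bsub>loc_ring\<^esub> r \<otimes>\<^bsub>loc_ring\<^esub> a \<in> I i"
      using r by auto
  qed
  then show ?thesis by (simp add: I_def M)
qed

section \<open>The Hilbert function of the example\<close>

definition exponent :: "nat \<Rightarrow> nat \<Rightarrow> nat \<Rightarrow> (3 \<Rightarrow>\<^sub>0 nat)" where
  "exponent p q r = Poly_Mapping.single 1 p + Poly_Mapping.single 2 q + Poly_Mapping.single 3 r"

lemma lookup_exponent [simp]:
  "Poly_Mapping.lookup (exponent p q r) 1 = p"
  "Poly_Mapping.lookup (exponent p q r) 2 = q"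
  "Poly_Mapping.lookup (exponent p q r) 3 = r"
  by (simp_all add: exponent_def lookup_add lookup_single when_def)

lemma exponent_eq_iff: "exponent p q r = exponent p' q' r' \<longleftrightarrow> p = p' \<and> q = q' \<and> r = r'"
  by (metis lookup_exponent)

lemma exponent_lookup:
  "exponent (Poly_Mapping.lookup v 1) (Poly_Mapping.lookup v 2) (Poly_Mapping.lookup v 3) = v"
proof (rule poly_mapping_eqI)
  have "\<forall>j. Poly_Mapping.lookup (exponent (Poly_Mapping.lookup v 1) (Poly_Mapping.lookup v 2) (Poly_Mapping.lookup v 3)) j
      = Poly_Mapping.lookup v j"
    unfolding forall_3 by simp
  then show "Poly_Mapping.lookup (exponent (Poly_Mapping.lookup v 1) (Poly_Mapping.lookup v 2) (Poly_Mapping.lookup v 3)) j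
      = Poly_Mapping.lookup v j" for j
    by blast
qed

lemma exponent_cases:
  obtains p q r where "v = exponent p q r"
  using exponent_lookup[of v] by metis

lemma exponent_add: "exponent p q r + exponent p' q' r' = exponent (p + p') (q + q') (r + r')"
  by (simp add: exponent_def single_add ac_simps)

lemma total_deg_exponent: "total_deg (exponent p q r) = p + q + r"
  by (simp add: total_deg_def sum_3)

text \<open>These are the exponents of the monomials in \<open>I\<^sup>n\<close>, as \<open>ideal_power_example_ideal\<close> shows: the three
  inequalities are the facet inequalities of the Newton polyhedron scaled by \<open>n\<close>, except for the
  nonnegativity of the coordinates.\<close>

definition power_exponents :: "nat \<Rightarrow> (3 \<Rightarrow>\<^sub>0 nat) set" where
  "power_exponents n = {exponent p q r | p q r. 2 * n \<le> p + q \<and> n \<le> q + r \<and> n \<le> p + r}"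

lemma exponent_in_power_exponents_iff:
  "exponent p q r \<in> power_exponents n \<longleftrightarrow> 2 * n \<le> p + q \<and> n \<le> q + r \<and> n \<le> p + r"
  by (auto simp: power_exponents_def exponent_eq_iff)

lemma upset_power_exponents: "upset (power_exponents n)"
  unfolding upset_def
proof (intro ballI allI)
  fix s t :: "3 \<Rightarrow>\<^sub>0 nat"
  assume s: "s \<in> power_exponents n"
  obtain p q r p' q' r' where "s = exponent p q r" "t = exponent p' q' r'"
    by (metis exponent_cases)
  with s show "s + t \<in> power_exponents n"
    by (auto simp: exponent_add exponent_in_power_exponents_iff)
qed

lemma power_exponents_0: "power_exponents 0 = UNIV"
proof -
  have "v \<in> power_exponents 0" for v
    by (rule exponent_cases[of v]) (simp add: exponent_in_power_exponents_iff)
  then show ?thesis by blast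
qed

definition generators :: "(3 \<Rightarrow>\<^sub>0 nat) set" where
  "generators = {exponent 2 0 1, exponent 0 2 1, exponent 1 1 0}"

text \<open>The generator \<open>xy\<close> can be split off unless \<open>p = 0\<close> or \<open>q = 0\<close>; in these cases \<open>y\<^sup>2z\<close> or \<open>x\<^sup>2z\<close>
  can be.\<close>

lemma power_exponents_Suc_generator:
  assumes "v \<in> power_exponents (Suc n)"
  obtains s t where "v = s + t" "s \<in> generators" "t \<in> power_exponents n"
proof -
  obtain p q r where v: "v = exponent p q r" by (rule exponent_cases)
  with assms have le: "2 * Suc n \<le> p + q" "Suc n \<le> q + r" "Suc n \<le> p + r"
    by (simp_all add: exponent_in_power_exponents_iff)
  consider "p = 0" | "q = 0" | "0 < p" "0 < q" by blast
  then show ?thesis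
  proof cases
    case 1
    have "v = exponent 0 2 1 + exponent 0 (q - 2) (r - 1)"
      using 1 le by (simp add: v exponent_add exponent_eq_iff)
    then show ?thesis
      by (rule that) (use 1 le in \<open>auto simp: generators_def exponent_in_power_exponents_iff\<close>)
  next
    case 2
    have "v = exponent 2 0 1 + exponent (p - 2) 0 (r - 1)"
      using 2 le by (simp add: v exponent_add exponent_eq_iff)
    then show ?thesis
      by (rule that) (use 2 le in \<open>auto simp: generators_def exponent_in_power_exponents_iff\<close>)
  next
    case 3
    have "v = exponent 1 1 0 + exponent (p - 1) (q - 1) r"
      using 3 le by (simp add: v exponent_add exponent_eq_iff)
    then show ?thesis
      by (rule that) (use 3 le in \<open>auto simp: generators_def exponent_in_power_exponents_iff\<close>)
  qed
qed

lemma generators_subset: "generators \<subseteq> power_exponents 1"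
  by (auto simp: generators_def exponent_in_power_exponents_iff)

lemma power_exponents_Suc:
  "{s + t | s t. s \<in> power_exponents 1 \<and> t \<in> power_exponents n} = power_exponents (Suc n)"
proof
  show "{s + t | s t. s \<in> power_exponents 1 \<and> t \<in> power_exponents n} \<subseteq> power_exponents (Suc n)"
    by (auto simp: power_exponents_def exponent_add exponent_eq_iff)
  show "power_exponents (Suc n) \<subseteq> {s + t | s t. s \<in> power_exponents 1 \<and> t \<in> power_exponents n}"
    using generators_subset by (blast elim: power_exponents_Suc_generator)
qed

definition example_ideal :: "('k::field, 3) mpoly fract set" where
  "example_ideal = Idl\<^bsub>loc_ring\<^esub> ((\<lambda>v. emb (monomial v)) ` generators)"

lemma example_ideal_eq: "example_ideal = mon_ideal (power_exponents 1)"
  unfolding example_ideal_def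
proof (rule Idl_monomials[OF upset_power_exponents generators_subset])
  fix v assume "v \<in> power_exponents 1"
  then have "v \<in> power_exponents (Suc 0)" by simp
  then show "\<exists>s\<in>generators. \<exists>t. v = s + t"
    by (rule power_exponents_Suc_generator) blast
qed

lemma ideal_power_example_ideal:
  "ideal_power loc_ring example_ideal n = mon_ideal (power_exponents n)"
proof (induction n)
  case (Suc n)
  then show ?case
    unfolding ideal_power.simps example_ideal_eq
    by (simp only: ideal_prod_mon_ideal[OF upset_power_exponents upset_power_exponents] power_exponents_Suc)
qed (simp add: power_exponents_0)

text \<open>The generator of \<open>I\<^sup>n\<close> of least degree dividing \<open>x\<^sup>p y\<^sup>q z\<^sup>r\<close> has degree
  \<open>2 n + max 0 (n - p) (n - q)\<close>. A monomial of \<open>I\<^sup>n\<close> lies in \<open>\<mm>\<^sup>d I\<^sup>n\<close> iff its own degree exceeds this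
  by at least \<open>d\<close>; the three inequalities below say this for the three terms of the maximum.\<close>

lemma max_power_mult_exponents:
  "exponent p q r \<in> {s + t | s t. s \<in> {v. d \<le> total_deg v} \<and> t \<in> power_exponents n} \<longleftrightarrow>
    exponent p q r \<in> power_exponents n \<and>
    2 * n + d \<le> p + q + r \<and> 3 * n + d \<le> p + 2 * q + r \<and> 3 * n + d \<le> 2 * p + q + r"
    (is "?L \<longleftrightarrow> ?R")
proof
  assume ?L
  then obtain s t where st: "exponent p q r = s + t" "d \<le> total_deg s" "t \<in> power_exponents n"
    by blast
  obtain p' q' r' p'' q'' r'' where "s = exponent p' q' r'" "t = exponent p'' q'' r''"
    by (metis exponent_cases)
  with st show ?R
    by (auto simp: exponent_add exponent_eq_iff exponent_in_power_exponents_iff total_deg_exponent)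
next
  assume R: ?R
  have split: "?L" if "a \<le> p" "b \<le> q" "c \<le> r" "exponent a b c \<in> power_exponents n"
    "d + (a + b + c) \<le> p + q + r" for a b c
  proof -
    have "exponent p q r = exponent (p - a) (q - b) (r - c) + exponent a b c"
      using that by (simp add: exponent_add)
    moreover have "d \<le> total_deg (exponent (p - a) (q - b) (r - c))"
      using that by (simp add: total_deg_exponent)
    ultimately show ?thesis using that by blast
  qed
  have le: "2 * n \<le> p + q" "n \<le> q + r" "n \<le> p + r"
    "2 * n + d \<le> p + q + r" "3 * n + d \<le> p + 2 * q + r" "3 * n + d \<le> 2 * p + q + r"
    using R by (simp_all add: exponent_in_power_exponents_iff)
  consider "p < n" | "q < n" | "n \<le> p" "n \<le> q" by linarith
  then show ?L
  proof cases
    case 1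
    then show ?thesis
      using le by (intro split[of p "2 * n - p" "n - p"]) (auto simp: exponent_in_power_exponents_iff)
  next
    case 2
    then show ?thesis
      using le by (intro split[of "2 * n - q" q "n - q"]) (auto simp: exponent_in_power_exponents_iff)
  next
    case 3
    then show ?thesis
      using le by (intro split[of n n 0]) (auto simp: exponent_in_power_exponents_iff)
  qed
qed

text \<open>The monomials of \<open>I\<^sup>n\<close> outside \<open>\<mm>\<^sup>v\<^sup>+\<^sup>1 I\<^sup>n + I\<^sup>n\<^sup>+\<^sup>1\<close> lie on one of the four planes
  \<open>p + q = 2 n\<close>, \<open>p + q = 2 n + 1\<close>, \<open>q + r = n\<close>, \<open>p + r = n\<close>.\<close>

definition layer :: "nat \<Rightarrow> nat \<Rightarrow> (nat \<times> nat \<times> nat) set" where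
  "layer n v = {(p, q, r). 2 * n \<le> p + q \<and> n \<le> q + r \<and> n \<le> p + r \<and>
    (p + q \<le> 2 * n + 1 \<or> q + r = n \<or> p + r = n) \<and>
    (p + q + r \<le> 2 * n + v \<or> p + 2 * q + r \<le> 3 * n + v \<or> 2 * p + q + r \<le> 3 * n + v)}"

text \<open>Each of the four planes is parametrized by a position \<open>t\<close> in the plane and a height \<open>s\<close> that the
  degree bound limits. On the last two planes \<open>s = p + q - 2 n\<close> starts at 2, since smaller values lie
  on the first two planes. The truncated sum \<open>(n - t) + (t - n)\<close> is \<open>\<bar>n - t\<bar>\<close>.\<close>

lemma layer_decomposition:
  "layer n v =
    (\<lambda>(t, s). (t, 2 * n - t, (n - t) + (t - n) + s)) ` ({..2 * n} \<times> {..v}) \<union>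
    (\<lambda>(t, s). (t, 2 * n + 1 - t, (n - t) + (t - (n + 1)) + s)) ` ({..2 * n + 1} \<times> {..<v}) \<union>
    (\<lambda>(t, s). (2 * n + s - t, t, n - t)) ` ({..n} \<times> {2..v}) \<union>
    (\<lambda>(t, s). (t, 2 * n + s - t, n - t)) ` ({..n} \<times> {2..v})"
  (is "_ = ?A \<union> ?B \<union> ?C \<union> ?D")
proof
  show "?A \<union> ?B \<union> ?C \<union> ?D \<subseteq> layer n v"
    by (auto simp: layer_def)
  show "layer n v \<subseteq> ?A \<union> ?B \<union> ?C \<union> ?D"
  proof
    fix x assume "x \<in> layer n v"
    obtain p q r where x: "x = (p, q, r)" by (cases x)
    have le: "2 * n \<le> p + q" "n \<le> q + r" "n \<le> p + r"
      "p + q \<le> 2 * n + 1 \<or> q + r = n \<or> p + r = n"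
      "p + q + r \<le> 2 * n + v \<or> p + 2 * q + r \<le> 3 * n + v \<or> 2 * p + q + r \<le> 3 * n + v"
      using \<open>x \<in> layer n v\<close> by (auto simp: layer_def x)
    consider "p + q = 2 * n" | "p + q = 2 * n + 1" | "2 * n + 2 \<le> p + q" "q + r = n"
      | "2 * n + 2 \<le> p + q" "p + r = n"
      using le by linarith
    then show "x \<in> ?A \<union> ?B \<union> ?C \<union> ?D"
    proof cases
      case 1
      then have "x \<in> ?A"
        using le by (intro image_eqI[of _ _ "(p, r - ((n - p) + (p - n)))"]) (auto simp: x)
      then show ?thesis by blast
    next
      case 2
      then have "x \<in> ?B"
        using le by (intro image_eqI[of _ _ "(p, r - ((n - p) + (p - (n + 1))))"]) (auto simp: x)
      then show ?thesis by blast
    next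
      case 3
      then have "x \<in> ?C"
        using le by (intro image_eqI[of _ _ "(q, p + q - 2 * n)"]) (auto simp: x)
      then show ?thesis by blast
    next
      case 4
      then have "x \<in> ?D"
        using le by (intro image_eqI[of _ _ "(p, p + q - 2 * n)"]) (auto simp: x)
      then show ?thesis by blast
    qed
  qed
qed

lemma card_layer:
  assumes "1 \<le> v"
  shows "finite (layer n v)" "int (card (layer n v)) = 6 * int n * int v + 5 * int v - 1"
proof -
  let ?f1 = "\<lambda>(t, s). (t, 2 * n - t, (n - t) + (t - n) + s :: nat)"
  let ?f2 = "\<lambda>(t, s). (t, 2 * n + 1 - t, (n - t) + (t - (n + 1)) + s :: nat)"
  let ?f3 = "\<lambda>(t, s). (2 * n + s - t, t, n - t :: nat)"
  let ?f4 = "\<lambda>(t, s). (t, 2 * n + s - t, n - t :: nat)"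
  let ?A = "?f1 ` ({..2 * n} \<times> {..v})"
  let ?B = "?f2 ` ({..2 * n + 1} \<times> {..<v})"
  let ?C = "?f3 ` ({..n} \<times> {2..v})"
  let ?D = "?f4 ` ({..n} \<times> {2..v})"
  have eq: "layer n v = ?A \<union> ?B \<union> ?C \<union> ?D"
    by (rule layer_decomposition)
  show "finite (layer n v)"
    unfolding eq by simp
  have "inj_on ?f1 ({..2 * n} \<times> {..v})" "inj_on ?f2 ({..2 * n + 1} \<times> {..<v})"
    "inj_on ?f3 ({..n} \<times> {2..v})" "inj_on ?f4 ({..n} \<times> {2..v})"
    by (auto simp: inj_on_def)
  then have c: "card ?A = (2 * n + 1) * (v + 1)" "card ?B = (2 * n + 2) * v"
    "card ?C = (n + 1) * (v - 1)" "card ?D = (n + 1) * (v - 1)"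
    by (simp_all only: card_image card_cartesian_product) (use assms in simp_all)
  have "?A \<inter> ?B = {}" "(?A \<union> ?B) \<inter> ?C = {}" "(?A \<union> ?B \<union> ?C) \<inter> ?D = {}"
    by auto
  then have "card (layer n v) = card ?A + card ?B + card ?C + card ?D"
    unfolding eq by (simp only: card_Un_disjoint finite_imageI finite_UnI finite_cartesian_product
      finite_atMost finite_lessThan finite_atLeastAtMost)
  then have "int (card (layer n v)) = int ((2 * n + 1) * (v + 1) + (2 * n + 2) * v + (n + 1) * (v - 1) + (n + 1) * (v - 1))"
    by (simp only: c)
  then show "int (card (layer n v)) = 6 * int n * int v + 5 * int v - 1"
    using assms by (cases v) (simp_all add: algebra_simps)
qed

lemma length_layer:
  assumes "1 \<le> v"
  shows "module_length loc_ring
      (quotient_module loc_ring (ideal_power loc_ring (example_ideal :: ('k::field, 3) mpoly fract set) n)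
         (ideal_prod loc_ring (ideal_power loc_ring loc_max (v + 1)) (ideal_power loc_ring example_ideal n)
            <+>\<^bsub>loc_ring\<^esub> ideal_power loc_ring example_ideal (n + 1))) = enat (card (layer n v))"
proof -
  let ?D = "{s + t | s t. s \<in> {w. v + 1 \<le> total_deg w} \<and> t \<in> power_exponents n}"
  let ?P = "?D \<union> power_exponents (n + 1)"
  have up: "upset ?D"
    unfolding upset_def
  proof (intro ballI allI)
    fix x u assume "x \<in> ?D"
    then obtain s t where st: "x = s + t" "s \<in> {w. v + 1 \<le> total_deg w}" "t \<in> power_exponents n"
      by blast
    then have "x + u = s + (t + u)" "t + u \<in> power_exponents n"
      using upset_power_exponents[of n] by (auto simp: upset_def add.assoc)
    with st show "x + u \<in> ?D" by blast
  qed
  have diff: "power_exponents n - ?P = (\<lambda>(p, q, r). exponent p q r) ` layer n v" (is "?L = ?R")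
  proof
    show "?L \<subseteq> ?R"
    proof
      fix w assume w: "w \<in> ?L"
      obtain p q r where e: "w = exponent p q r" by (rule exponent_cases)
      have "(p, q, r) \<in> layer n v"
        using w unfolding e Diff_iff Un_iff max_power_mult_exponents
        by (auto simp: exponent_in_power_exponents_iff layer_def)
      then show "w \<in> ?R" by (force simp: e)
    qed
    show "?R \<subseteq> ?L"
    proof
      fix w assume "w \<in> ?R"
      then obtain p q r where e: "w = exponent p q r" and "(p, q, r) \<in> layer n v" by auto
      then show "w \<in> ?L"
        unfolding e Diff_iff Un_iff max_power_mult_exponents
        by (auto simp: exponent_in_power_exponents_iff layer_def)
    qed
  qed
  have sub: "?P \<subseteq> power_exponents n"
  proof
    fix w assume "w \<in> ?P"
    moreover obtain p q r where e: "w = exponent p q r" by (rule exponent_cases)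
    ultimately show "w \<in> power_exponents n"
      unfolding e Un_iff max_power_mult_exponents by (auto simp: exponent_in_power_exponents_iff)
  qed
  have inj: "inj_on (\<lambda>(p, q, r). exponent p q r) (layer n v)"
    by (auto simp: inj_on_def exponent_eq_iff)
  have "module_length loc_ring (quotient_module loc_ring
      (mon_ideal (power_exponents n) :: ('k, 3) mpoly fract set) (mon_ideal ?P)) =
    enat (card (power_exponents n - ?P))"
    by (intro module_length_mon_ideal upset_Un up upset_power_exponents sub)
      (simp only: diff finite_imageI card_layer[OF assms])
  then show ?thesis
    unfolding ideal_power_example_ideal ideal_power_loc_max
      ideal_prod_mon_ideal[OF upset_total_deg upset_power_exponents]
      set_add_mon_ideal[OF up upset_power_exponents]
    by (simp only: diff card_image[OF inj])
qed

lemma hilbert_sum_example: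
  assumes "1 \<le> v"
  shows "ereal_of_enat (hilbert_sum loc_ring loc_max (example_ideal :: ('k::field, 3) mpoly fract set) u v) =
    ereal (3 * real u ^ 2 * real v + 8 * real u * real v + 5 * real v - real u - 1)"
proof -
  have "hilbert_sum loc_ring loc_max (example_ideal :: ('k, 3) mpoly fract set) u v =
      enat (\<Sum>n=0..u. card (layer n v))"
    unfolding hilbert_sum_def length_layer[OF assms] by (induction u) (auto simp: zero_enat_def)
  moreover have "real (\<Sum>n=0..u. card (layer n v)) =
      3 * real u ^ 2 * real v + 8 * real u * real v + 5 * real v - real u - 1"
  proof (induction u)
    case 0
    have "real (card (layer 0 v)) = real_of_int (int (card (layer 0 v)))" by simp
    also have "\<dots> = 5 * real v - 1" unfolding card_layer[OF assms] by simp
    finally show ?case by simp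
  next
    case (Suc u)
    have "real (card (layer (Suc u) v)) = real_of_int (int (card (layer (Suc u) v)))" by simp
    also have "\<dots> = 6 * real (Suc u) * real v + 5 * real v - 1" unfolding card_layer[OF assms] by simp
    finally show ?case using Suc by (simp add: algebra_simps power2_eq_square)
  qed
  ultimately show ?thesis by simp
qed

section \<open>The multiplicity of the example\<close>

lemma sum_cubic_exponents:
  fixes f :: "nat \<Rightarrow> nat \<Rightarrow> 'a::comm_monoid_add"
  shows "(\<Sum>(i, j) \<in> {(i, j). i + j \<le> 3}. f i j) =
    f 0 0 + f 0 1 + f 0 2 + f 0 3 + f 1 0 + f 1 1 + f 1 2 + f 2 0 + f 2 1 + f 3 0"
proof -
  have "{(i, j). i + j \<le> 3} = (SIGMA i:{..3}. {..3 - i :: nat})"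
    by auto
  then have "(\<Sum>(i, j) \<in> {(i, j). i + j \<le> 3}. f i j) = (\<Sum>i\<le>3. \<Sum>j\<le>3 - i. f i j)"
    by (simp add: sum.Sigma)
  then show ?thesis
    by (simp add: eval_nat_numeral ac_simps)
qed

text \<open>The second difference in \<open>u\<close> followed by the first difference in \<open>v\<close> annihilates every
  monomial of degree at most 3 except \<open>u\<^sup>2 v\<close>, so it reads off the coefficient of that monomial.\<close>

lemma coefficient_of_cubic:
  fixes c :: "nat \<Rightarrow> nat \<Rightarrow> real"
  assumes F: "\<And>u v. F u v = (\<Sum>(i, j) \<in> {(i, j). i + j \<le> 3}. c i j * real u ^ i * real v ^ j)"
  shows "F (n + 2) (n + 1) - 2 * F (n + 1) (n + 1) + F n (n + 1)
    - (F (n + 2) n - 2 * F (n + 1) n + F n n) = 2 * c 2 1"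
  unfolding F sum_cubic_exponents
  by (simp add: algebra_simps power2_eq_square power3_eq_cube)

lemma loc_mult_example:
  "loc_mult (example_ideal :: ('k::field, 3) mpoly fract set) 1 = 6"
proof -
  let ?H = "\<lambda>u v :: nat. 3 * real u ^ 2 * real v + 8 * real u * real v + 5 * real v - real u - 1"
  let ?hp = "is_hilbert_polynomial 3 loc_ring loc_max (example_ideal :: ('k, 3) mpoly fract set)"
  define a0 :: "nat \<Rightarrow> nat \<Rightarrow> rat" where
    "a0 = (\<lambda>i j. if (i, j) = (2, 1) then 3 else if (i, j) = (1, 1) then 8 else if (i, j) = (0, 1) then 5
      else if (i, j) = (1, 0) then - 1 else if (i, j) = (0, 0) then - 1 else 0)"
  have a0: "?hp a0"
    unfolding is_hilbert_polynomial_def sum_cubic_exponents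
    by (intro exI[of _ 1])
      (auto simp: hilbert_sum_example a0_def of_rat_add of_rat_mult of_rat_power of_rat_diff of_rat_minus)
  have uniq: "a 2 1 = 3" if hp: "?hp a" for a
  proof -
    obtain n where n: "\<And>u v. u \<ge> n \<Longrightarrow> v \<ge> n \<Longrightarrow>
        ereal_of_enat (hilbert_sum loc_ring loc_max (example_ideal :: ('k, 3) mpoly fract set) u v) =
        ereal (real_of_rat (\<Sum>(i, j) \<in> {(i, j). i + j \<le> 3}. a i j * of_nat u ^ i * of_nat v ^ j))"
      using hp unfolding is_hilbert_polynomial_def by blast
    define F where "F = (\<lambda>u v. \<Sum>(i, j) \<in> {(i, j). i + j \<le> 3}. real_of_rat (a i j) * real u ^ i * real v ^ j)"
    \<comment> \<open>The formula for the Hilbert function needs \<open>1 \<le> v\<close>, which \<open>Suc n\<close> guarantees.\<close>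
    have F: "F u v = ?H u v" if "Suc n \<le> u" "Suc n \<le> v" for u v
    proof -
      have "real_of_rat (\<Sum>(i, j) \<in> {(i, j). i + j \<le> 3}. a i j * of_nat u ^ i * of_nat v ^ j) = F u v"
        by (simp add: F_def sum_cubic_exponents of_rat_add of_rat_mult of_rat_power)
      then show ?thesis
        using n[of u v] hilbert_sum_example[where 'k = 'k, of v u] that by simp
    qed
    have "2 * real_of_rat (a 2 1) = F (Suc n + 2) (Suc n + 1) - 2 * F (Suc n + 1) (Suc n + 1) + F (Suc n) (Suc n + 1)
        - (F (Suc n + 2) (Suc n) - 2 * F (Suc n + 1) (Suc n) + F (Suc n) (Suc n))"
      by (rule coefficient_of_cubic[symmetric]) (simp add: F_def)
    also have "\<dots> = 6"
      by (simp add: F algebra_simps power2_eq_square)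
    finally have "real_of_rat (a 2 1) = real_of_rat 3" by simp
    then show ?thesis by (simp only: of_rat_eq_iff)
  qed
  have "mult_seq 3 loc_ring loc_max (example_ideal :: ('k, 3) mpoly fract set) 1 = 6"
    unfolding mult_seq_def
  proof (rule the_equality)
    show "\<exists>a. ?hp a \<and> a (3 - 1) 1 = of_nat 6 / (fact (3 - 1) * fact 1)"
      using a0 by (intro exI[of _ a0]) (auto simp: a0_def)
    fix c :: nat
    assume "\<exists>a. ?hp a \<and> a (3 - 1) 1 = of_nat c / (fact (3 - 1) * fact 1)"
    then obtain a where "?hp a" "a (3 - 1) 1 = of_nat c / (fact (3 - 1) * fact 1)" by blast
    with uniq[of a] have "(3 :: rat) = of_nat c / 2" by simp
    then have "(of_nat c :: rat) = of_nat 6" by simp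
    then show "c = 6" by (simp only: of_nat_eq_iff)
  qed
  then show ?thesis
    by (simp add: loc_mult_def)
qed

section \<open>Edges and facets of the Newton polyhedron\<close>

text \<open>A face is spanned by the generating points that it contains: the points of the hull of \<open>F \<inter> T\<close>
  together with the points outside \<open>F\<close> form a convex set, as a segment with an interior point in \<open>F\<close>
  has both ends in \<open>F\<close>.\<close>

lemma face_of_convex_hull_eq:
  assumes F: "F face_of convex hull T"
  shows "F = convex hull (F \<inter> T)"
proof
  have cF: "convex F" using F by (rule face_of_imp_convex)
  show "convex hull (F \<inter> T) \<subseteq> F"
    using cF by (intro hull_minimal) auto
  let ?H = "convex hull (F \<inter> T)"
  let ?K = "?H \<union> (convex hull T - F)"
  have HF: "?H \<subseteq> F" by fact
  have HT: "?H \<subseteq> convex hull T" by (intro hull_mono) blast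
  have "z \<in> ?K" if x: "x \<in> ?K" and y: "y \<in> ?K" and z: "z \<in> closed_segment x y" for x y z
  proof -
    have xy: "x \<in> convex hull T" "y \<in> convex hull T"
      using x y HT by auto
    then have zT: "z \<in> convex hull T"
      using z convex_convex_hull[of T] by (auto simp: convex_contains_segment)
    show "z \<in> ?K"
    proof (cases "z \<in> F \<and> z \<noteq> x \<and> z \<noteq> y")
      case True
      then have "z \<in> open_segment x y"
        using z by (auto simp: open_segment_def)
      then have "x \<in> F" "y \<in> F"
        using face_ofD[OF F _ xy] True by blast+
      then have "x \<in> ?H" "y \<in> ?H" using x y by auto
      then have "z \<in> ?H"
        using z convex_convex_hull[of "F \<inter> T"] by (auto simp: convex_contains_segment)
      then show ?thesis by blast
    next
      case False
      then show ?thesis using x y zT by blast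
    qed
  qed
  then have "convex ?K"
    by (subst convex_contains_segment) blast
  moreover have "T \<subseteq> ?K"
    by (auto intro: hull_inc)
  ultimately have "convex hull T \<subseteq> ?K"
    by (intro hull_minimal)
  then show "F \<subseteq> ?H"
    using face_of_imp_subset[OF F] by blast
qed

lemma unbounded_direction_recession:
  assumes j: "j \<in> unbounded_directions F" and x: "x \<in> F" and s: "0 \<le> s"
  shows "x + s *\<^sub>R axis j 1 \<in> F"
proof -
  obtain U where U: "j \<in> U" and F: "F = {p + (\<Sum>j\<in>U. t j *\<^sub>R axis j 1) | p t.
        p \<in> convex hull {b. b extreme_point_of F} \<and> (\<forall>j\<in>U. 0 \<le> t j)}"
    using j unfolding unbounded_directions_def by blast
  obtain p t where p: "p \<in> convex hull {b. b extreme_point_of F}" and t: "\<forall>j\<in>U. 0 \<le> t j"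
    and x: "x = p + (\<Sum>j\<in>U. t j *\<^sub>R axis j 1)"
    using x by (subst (asm) F) blast
  define t' where "t' i = t i + (if i = j then s else 0)" for i
  have "(\<Sum>i\<in>U. t' i *\<^sub>R axis i 1) =
      (\<Sum>i\<in>U. t i *\<^sub>R axis i 1) + (\<Sum>i\<in>U. if i = j then s *\<^sub>R axis j 1 else 0)"
    unfolding sum.distrib[symmetric] by (intro sum.cong) (auto simp: t'_def scaleR_add_left)
  also have "(\<Sum>i\<in>U. if i = j then s *\<^sub>R axis j 1 else 0) = s *\<^sub>R axis j (1 :: real)"
    using U by simp
  finally have "x + s *\<^sub>R axis j 1 = p + (\<Sum>i\<in>U. t' i *\<^sub>R axis i 1)"
    by (simp add: x add.assoc)
  moreover have "\<forall>i\<in>U. 0 \<le> t' i"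
    using t s by (auto simp: t'_def)
  ultimately show ?thesis
    using p by (subst F) blast
qed

abbreviation point :: "real \<Rightarrow> real \<Rightarrow> real \<Rightarrow> real^3" where
  "point p q r \<equiv> vector [p, q, r]"

lemma point_eq_iff: "point p q r = point p' q' r' \<longleftrightarrow> p = p' \<and> q = q' \<and> r = r'"
  by (auto simp: vec_eq_iff forall_3)

lemma point_algebra:
  "point p q r + point p' q' r' = point (p + p') (q + q') (r + r')"
  "point p q r - point p' q' r' = point (p - p') (q - q') (r - r')"
  "c *\<^sub>R point p q r = point (c * p) (c * q) (c * r)"
  by (simp_all add: vec_eq_iff forall_3)

lemma point_axis:
  "axis 1 1 = point 1 0 0" "axis 2 1 = point 0 1 0" "axis 3 1 = point 0 0 1"
  "0 = point 0 0 0"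
  by (simp_all add: vec_eq_iff forall_3 axis_def)

lemma point_inner: "point a b c \<bullet> x = a * x $ 1 + b * x $ 2 + c * x $ 3"
  by (simp add: inner_vec_def sum_3)

definition lattice_points :: "(real^3) set" where
  "lattice_points = {point (real p) (real q) (real r) | p q r. 2 \<le> p + q \<and> 1 \<le> q + r \<and> 1 \<le> p + r}"

abbreviation polyhedron_I :: "(real^3) set" where
  "polyhedron_I \<equiv> convex hull lattice_points"

abbreviation "vertex_A \<equiv> point 2 0 1"
abbreviation "vertex_B \<equiv> point 0 2 1"
abbreviation "vertex_C \<equiv> point 1 1 0"

lemma lattice_pointsI:
  "2 \<le> p + q \<Longrightarrow> 1 \<le> q + r \<Longrightarrow> 1 \<le> p + r \<Longrightarrow> point (real p) (real q) (real r) \<in> lattice_points"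
  unfolding lattice_points_def by blast

lemma vertices_in_lattice_points:
  "vertex_A \<in> lattice_points" "vertex_B \<in> lattice_points" "vertex_C \<in> lattice_points"
  using lattice_pointsI[of 2 0 1] lattice_pointsI[of 0 2 1] lattice_pointsI[of 1 1 0] by simp_all

lemma lattice_point_decomposition:
  assumes "w \<in> lattice_points"
  obtains s p q r where "s \<in> {vertex_A, vertex_B, vertex_C}" "w = s + point (real p) (real q) (real r)"
    "\<And>k. s + real k *\<^sub>R point (real p) (real q) (real r) \<in> lattice_points"
proof -
  obtain p q r where w: "w = point (real p) (real q) (real r)" "2 \<le> p + q" "1 \<le> q + r" "1 \<le> p + r"
    using assms unfolding lattice_points_def by blast
  note decomposition = that
  have step: thesis
    if s: "point (real a) (real b) (real c) \<in> {vertex_A, vertex_B, vertex_C}"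
      and le: "a \<le> p" "b \<le> q" "c \<le> r" and "2 \<le> a + b" "1 \<le> b + c" "1 \<le> a + c" for a b c
  proof (rule decomposition[OF s])
    show "w = point (real a) (real b) (real c) + point (real (p - a)) (real (q - b)) (real (r - c))"
      using le by (simp add: w point_algebra of_nat_diff)
    show "point (real a) (real b) (real c) + real k *\<^sub>R point (real (p - a)) (real (q - b)) (real (r - c)) \<in> lattice_points" for k
      using lattice_pointsI[of "a + k * (p - a)" "b + k * (q - b)" "c + k * (r - c)"] that
      by (simp add: point_algebra)
  qed
  consider "p = 0" | "q = 0" | "0 < p" "0 < q" by blast
  then show thesis
  proof cases
    case 1
    then show ?thesis using w by (intro step[of 0 2 1]) auto
  next
    case 2
    then show ?thesis using w by (intro step[of 2 0 1]) auto
  next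
    case 3
    then show ?thesis using w by (intro step[of 1 1 0]) auto
  qed
qed

text \<open>A lattice point other than \<open>A\<close>, \<open>B\<close>, \<open>C\<close> lies inside a segment that starts at one of them and can be
  prolonged indefinitely within the polyhedron, so a face that contains it is unbounded.\<close>

lemma bounded_face_lattice_points:
  assumes G: "G face_of polyhedron_I" and bdd: "bounded G"
  shows "G \<inter> lattice_points \<subseteq> {vertex_A, vertex_B, vertex_C}"
proof
  fix w assume w: "w \<in> G \<inter> lattice_points"
  then obtain s p q r where s: "s \<in> {vertex_A, vertex_B, vertex_C}"
    and ws: "w = s + point (real p) (real q) (real r)"
    and ray: "\<And>k. s + real k *\<^sub>R point (real p) (real q) (real r) \<in> lattice_points"
    using lattice_point_decomposition[of w] by blast
  let ?n = "point (real p) (real q) (real r)"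
  show "w \<in> {vertex_A, vertex_B, vertex_C}"
  proof (cases "?n = 0")
    case True
    then show ?thesis using s ws by simp
  next
    case False
    have far: "s + real k *\<^sub>R ?n \<in> G" if "2 \<le> k" for k
    proof -
      have "w \<in> open_segment s (s + real k *\<^sub>R ?n)"
        unfolding in_segment using False that
        by (auto intro!: exI[of _ "1 / real k"] simp: ws algebra_simps scaleR_left_diff_distrib)
      then show ?thesis
        using face_ofD[OF G, of w s "s + real k *\<^sub>R ?n"] w ray[of k] ray[of 0] hull_inc[of _ lattice_points]
        by auto
    qed
    obtain M where M: "\<And>x. x \<in> G \<Longrightarrow> norm x \<le> M"
      using bdd by (auto simp: bounded_iff)
    obtain j where j: "1 \<le> ?n $ j"
    proof -
      have "1 \<le> p \<or> 1 \<le> q \<or> 1 \<le> r"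
        using False by (auto simp: point_axis point_eq_iff)
      then have "1 \<le> ?n $ 1 \<or> 1 \<le> ?n $ 2 \<or> 1 \<le> ?n $ 3" by auto
      then show ?thesis using that by blast
    qed
    have s0: "0 \<le> s $ j"
    proof -
      have "\<forall>j. 0 \<le> s $ j" using s unfolding forall_3 by auto
      then show ?thesis by blast
    qed
    obtain k :: nat where k: "max M 2 < real k"
      using reals_Archimedean2 by blast
    have "real k \<le> real k * ?n $ j" using j by (simp add: mult_le_cancel_left1)
    also have "\<dots> \<le> (s + real k *\<^sub>R ?n) $ j" using s0 by simp
    also have "\<dots> \<le> norm (s + real k *\<^sub>R ?n)"
      using component_le_norm_cart[of "s + real k *\<^sub>R ?n" j] by linarith
    also have "\<dots> \<le> M" using k by (intro M far) simp
    finally show ?thesis using k by simp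
  qed
qed

text \<open>The midpoint of \<open>A\<close> and \<open>B\<close> is the lattice point \<open>(1, 1, 1)\<close>, which lies on no bounded face, so no bounded
  face contains both \<open>A\<close> and \<open>B\<close>.\<close>

lemma bounded_edges:
  assumes "G \<in> bounded_faces 1 polyhedron_I"
  shows "G = convex hull {vertex_A, vertex_C} \<or> G = convex hull {vertex_B, vertex_C}"
proof -
  have G: "G face_of polyhedron_I" "bounded G" "aff_dim G = 1"
    using assms by (auto simp: bounded_faces_def)
  let ?V = "G \<inter> lattice_points"
  have hull: "G = convex hull ?V" by (rule face_of_convex_hull_eq[OF G(1)])
  have V: "?V \<subseteq> {vertex_A, vertex_B, vertex_C}"
    by (rule bounded_face_lattice_points[OF G(1,2)])
  have "\<not> (vertex_A \<in> G \<and> vertex_B \<in> G)"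
  proof
    assume "vertex_A \<in> G \<and> vertex_B \<in> G"
    then have "(1 / 2) *\<^sub>R vertex_A + (1 / 2) *\<^sub>R vertex_B \<in> G"
      using face_of_imp_convex[OF G(1)] by (intro convexD) auto
    then have "point 1 1 1 \<in> ?V"
      using lattice_pointsI[of 1 1 1] by (simp add: point_algebra)
    then show False using V by (auto simp: point_eq_iff)
  qed
  then have "?V \<subseteq> {vertex_A, vertex_C} \<or> ?V \<subseteq> {vertex_B, vertex_C}"
    using V by blast
  moreover have "\<not> ?V \<subseteq> {a}" for a
  proof
    assume "?V \<subseteq> {a}"
    then have "aff_dim ?V \<le> aff_dim {a}" by (rule aff_dim_subset)
    then show False
      using G(3) hull aff_dim_convex_hull[of ?V] by simp
  qed
  ultimately have "?V = {vertex_A, vertex_C} \<or> ?V = {vertex_B, vertex_C}"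
    by blast
  then show ?thesis using hull by metis
qed

lemma face_eq_plane_section:
  fixes F \<Gamma> :: "(real^3) set"
  assumes F: "F face_of \<Gamma>" "convex \<Gamma>" "aff_dim F = 2"
    and S: "{p, q, r} \<subseteq> F" "\<not> collinear {p, q, r}"
    and n: "n \<noteq> 0" "n \<bullet> p = b" "n \<bullet> q = b" "n \<bullet> r = b"
  shows "F = \<Gamma> \<inter> {x. n \<bullet> x = b}"
proof -
  have dS: "2 \<le> aff_dim {p, q, r}"
    using S(2) by (simp add: collinear_aff_dim)
  have 1: "affine hull {p, q, r} = affine hull F"
  proof (rule ccontr)
    assume "affine hull {p, q, r} \<noteq> affine hull F"
    then have "affine hull {p, q, r} \<subset> affine hull F"
      using hull_mono[OF S(1), of affine] by blast
    then have "aff_dim {p, q, r} < aff_dim F" by (rule aff_dim_psubset)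
    with dS F(3) show False by simp
  qed
  have dH: "aff_dim {x. n \<bullet> x = b} = 2"
    using n(1) by simp
  have 2: "affine hull {p, q, r} = affine hull {x. n \<bullet> x = b}"
  proof (rule ccontr)
    assume "affine hull {p, q, r} \<noteq> affine hull {x. n \<bullet> x = b}"
    then have "affine hull {p, q, r} \<subset> affine hull {x. n \<bullet> x = b}"
      using hull_mono[of "{p, q, r}" "{x. n \<bullet> x = b}" affine] n by blast
    then have "aff_dim {p, q, r} < aff_dim {x. n \<bullet> x = b}" by (rule aff_dim_psubset)
    with dS dH show False by simp
  qed
  have "affine hull {x. n \<bullet> x = b} = {x. n \<bullet> x = b}"
    by (rule hull_same) (rule affine_hyperplane)
  with 1 2 have "affine hull F = {x. n \<bullet> x = b}" by simp
  then show ?thesis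
    using face_of_imp_eq_affine_Int[OF F(2,1)] by blast
qed

definition plane_section :: "real^3 \<Rightarrow> real \<Rightarrow> (real^3) set" where
  "plane_section n b = polyhedron_I \<inter> {x. n \<bullet> x = b}"

text \<open>The edge \<open>PC\<close> and the direction \<open>e\<^sub>j\<close> span the plane of the facet. Of the six combinations, the edge
  \<open>AC\<close> with \<open>e\<^sub>2\<close> and the edge \<open>BC\<close> with \<open>e\<^sub>1\<close> are impossible: \<open>A + 2 e\<^sub>2\<close> is the midpoint of \<open>B\<close> and
  \<open>B + 4 e\<^sub>1\<close>, so in the first case the facet would contain \<open>B\<close> as well, which is not on its plane; the
  second case is the mirror image.\<close>

lemma facets_with_bounded_edge:
  assumes "F \<in> facets_F polyhedron_I 1"
  obtains j P where "j \<in> unbounded_directions F" "convex hull {P, vertex_C} \<subseteq> F"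
    "convex hull {P, vertex_C} \<in> bounded_faces 1 polyhedron_I"
    "(j = 3 \<and> (P = vertex_A \<or> P = vertex_B) \<and> F = plane_section (point 1 1 0) 2) \<or>
     (j = 1 \<and> P = vertex_A \<and> F = plane_section (point 0 1 1) 1) \<or>
     (j = 2 \<and> P = vertex_B \<and> F = plane_section (point 1 0 1) 1)"
proof -
  have F: "F face_of polyhedron_I" "aff_dim F = 2" "1 \<le> card (unbounded_directions F)"
    "\<exists>G \<in> bounded_faces 1 polyhedron_I. G \<subseteq> F"
    using assms by (auto simp: facets_F_def)
  obtain j where j: "j \<in> unbounded_directions F"
    using F(3) by (metis card.empty ex_in_conv not_one_le_zero)
  obtain P where P: "P = vertex_A \<or> P = vertex_B" and sub: "convex hull {P, vertex_C} \<subseteq> F"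
    and bf: "convex hull {P, vertex_C} \<in> bounded_faces 1 polyhedron_I"
    using F(4) bounded_edges by metis
  have PF: "P \<in> F" "vertex_C \<in> F"
    using sub hull_subset[of "{P, vertex_C}" convex] by auto
  have rec: "P + s *\<^sub>R axis j 1 \<in> F" if "0 \<le> s" for s
    by (rule unbounded_direction_recession[OF j PF(1) that])
  have jj: "j = 1 \<or> j = 2 \<or> j = 3"
    using exhaust_3 by blast
  have ncol: "\<not> collinear {vertex_C, P, P + axis j 1}"
  proof
    assume "collinear {vertex_C, P, P + axis j 1}"
    then have "collinear {0, vertex_C - P, axis j 1}"
      by (subst (asm) collinear_3) (simp_all add: algebra_simps)
    then have "vertex_C - P = 0 \<or> axis j (1 :: real) = 0 \<or> (\<exists>c. axis j 1 = c *\<^sub>R (vertex_C - P))"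
      by (simp add: collinear_lemma)
    then show False
      using P jj by (auto simp: point_axis point_algebra point_eq_iff)
  qed
  have plane: "F = plane_section n (n \<bullet> P)"
    if "n \<noteq> 0" "n \<bullet> vertex_C = n \<bullet> P" "n \<bullet> axis j 1 = 0" for n
    unfolding plane_section_def
    using that PF rec[of 1] ncol
    by (intro face_eq_plane_section[of F _ vertex_C P "P + axis j 1"] F convex_convex_hull)
      (auto simp: inner_add_right)
  have inF: "x \<in> F" if "x \<in> lattice_points" "y \<in> lattice_points" "x \<noteq> y"
    "(1 / 2) *\<^sub>R x + (1 / 2) *\<^sub>R y \<in> F" for x y
  proof -
    have "(1 / 2) *\<^sub>R x + (1 / 2) *\<^sub>R y \<in> open_segment x y"
      using that(3) by (auto simp: in_segment intro!: exI[of _ "1 / 2"])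
    then show ?thesis
      using face_ofD[OF F(1)] that hull_inc[of _ lattice_points] by blast
  qed
  have not_A2: "\<not> (P = vertex_A \<and> j = 2)"
  proof
    assume a: "P = vertex_A \<and> j = 2"
    have "vertex_B \<in> F"
    proof (rule inF[of _ "point 4 2 1"])
      show "point 4 2 1 \<in> lattice_points" using lattice_pointsI[of 4 2 1] by simp
      show "(1 / 2) *\<^sub>R vertex_B + (1 / 2) *\<^sub>R point 4 2 1 \<in> F"
        using rec[of 2] a by (simp add: point_axis point_algebra)
    qed (simp_all add: vertices_in_lattice_points point_eq_iff)
    then show False
      using plane[of "point 1 0 (-1)"] a
      by (simp add: point_inner point_axis point_eq_iff plane_section_def)
  qed
  have not_B1: "\<not> (P = vertex_B \<and> j = 1)"
  proof
    assume a: "P = vertex_B \<and> j = 1"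
    have "vertex_A \<in> F"
    proof (rule inF[of _ "point 2 4 1"])
      show "point 2 4 1 \<in> lattice_points" using lattice_pointsI[of 2 4 1] by simp
      show "(1 / 2) *\<^sub>R vertex_A + (1 / 2) *\<^sub>R point 2 4 1 \<in> F"
        using rec[of 2] a by (simp add: point_axis point_algebra)
    qed (simp_all add: vertices_in_lattice_points point_eq_iff)
    then show False
      using plane[of "point 0 1 (-1)"] a
      by (simp add: point_inner point_axis point_eq_iff plane_section_def)
  qed
  show thesis
  proof (rule that[OF j sub bf])
    consider "j = 3" | "j = 1" "P = vertex_A" | "j = 2" "P = vertex_B"
      using jj P not_A2 not_B1 by blast
    then show "(j = 3 \<and> (P = vertex_A \<or> P = vertex_B) \<and> F = plane_section (point 1 1 0) 2) \<or>
     (j = 1 \<and> P = vertex_A \<and> F = plane_section (point 0 1 1) 1) \<or>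
     (j = 2 \<and> P = vertex_B \<and> F = plane_section (point 1 0 1) 1)"
    proof cases
      case 1
      then show ?thesis
        using P plane[of "point 1 1 0"] by (auto simp: point_inner point_axis point_eq_iff)
    next
      case 2
      then show ?thesis
        using plane[of "point 0 1 1"] by (auto simp: point_inner point_axis point_eq_iff)
    next
      case 3
      then show ?thesis
        using plane[of "point 1 0 1"] by (auto simp: point_inner point_axis point_eq_iff)
    qed
  qed
qed

section \<open>Volumes and the failure of the formula\<close>

lemma linear_coord_proj: "linear (coord_proj M)"
  by (rule linearI) (auto simp: coord_proj_def vec_eq_iff)

text \<open>The minimum over the sets \<open>M\<close> is bounded by its value at \<open>M = {j}\<close>, and the projected triangle by a
  convex set \<open>K\<close> whose coordinates lie in a measurable set \<open>B\<close>.\<close>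

lemma Vol_edge_le:
  fixes F :: "(real^3) set"
  assumes j: "j \<in> unbounded_directions F" and PQ: "coord_proj {j} P \<noteq> coord_proj {j} Q"
    and K: "convex K" "0 \<in> K" "coord_proj {j} P \<in> K" "coord_proj {j} Q \<in> K"
    and B: "(\<lambda>x. restrict (\<lambda>i. x $ i) (- {j})) ` K \<subseteq> B" "B \<in> sets (Pi\<^sub>M (- {j}) (\<lambda>_. lborel))"
  shows "Vol 1 (convex hull {P, Q}) F \<le> 2 * emeasure (Pi\<^sub>M (- {j}) (\<lambda>_. lborel)) B"
proof -
  let ?G = "convex hull {P, Q}"
  let ?M = "{M. M \<subseteq> unbounded_directions F \<and> card M = CARD(3) - (1 + 1) \<and>
      aff_dim (coord_proj M ` ?G) = int 1}"
  have im: "coord_proj {j} ` ?G = convex hull {coord_proj {j} P, coord_proj {j} Q}"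
    using convex_hull_linear_image[OF linear_coord_proj, of "{j}" "{P, Q}"] by simp
  have "{j} \<in> ?M"
    using j PQ by (simp add: im aff_dim_convex_hull aff_dim_2)
  then have "(INF M \<in> ?M. coord_vol (- M) (convex hull (insert 0 (coord_proj M ` ?G))))
      \<le> coord_vol (- {j}) (convex hull (insert 0 (coord_proj {j} ` ?G)))"
    by (rule INF_lower)
  also have "\<dots> \<le> emeasure (Pi\<^sub>M (- {j}) (\<lambda>_. lborel)) B"
  proof -
    have "convex hull {coord_proj {j} P, coord_proj {j} Q} \<subseteq> K"
      using K by (intro hull_minimal) auto
    then have "convex hull (insert 0 (coord_proj {j} ` ?G)) \<subseteq> K"
      using K by (intro hull_minimal) (auto simp: im)
    then show ?thesis
      unfolding coord_vol_def using B by (intro emeasure_mono) auto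
  qed
  finally show ?thesis
    unfolding Vol_def by (intro mult_mono) (auto simp: numeral_2_eq_2)
qed

lemma two_times_half_ennreal: "2 * ennreal (1 / 2) = 1"
proof -
  have "ennreal 2 * ennreal (1 / 2) = ennreal (2 * (1 / 2))"
    by (rule ennreal_mult[symmetric]) simp_all
  then show ?thesis by (simp only: ennreal_numeral) simp
qed

lemma Compl_singletons_3: "- {1} = {2, 3 :: 3}" "- {2} = {1, 3 :: 3}" "- {3} = {1, 2 :: 3}"
  using exhaust_3 by auto

lemma emeasure_box:
  assumes "finite J" "\<And>i. i \<in> J \<Longrightarrow> l i \<le> u i"
  shows "emeasure (Pi\<^sub>M J (\<lambda>_. lborel)) (Pi\<^sub>E J (\<lambda>i. {l i..u i})) = ennreal (\<Prod>i\<in>J. u i - l i)"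
proof -
  interpret product_sigma_finite "\<lambda>_. lborel :: real measure"
    by standard
  show ?thesis
    using assms by (subst emeasure_PiM) (simp_all add: prod_ennreal)
qed

text \<open>The projected triangle lies in the standard triangle, which has area 1/2.\<close>

lemma Vol_standard_triangle:
  fixes F :: "(real^3) set"
  assumes j: "j \<in> unbounded_directions F" and PQ: "coord_proj {j} P \<noteq> coord_proj {j} Q"
    and pos: "\<And>i. i \<in> - {j} \<Longrightarrow> 0 \<le> P $ i \<and> 0 \<le> Q $ i"
    and le: "(\<Sum>i\<in>- {j}. P $ i) \<le> 1" "(\<Sum>i\<in>- {j}. Q $ i) \<le> 1"
  shows "Vol 1 (convex hull {P, Q}) F \<le> 1"
proof -
  let ?J = "- {j}"
  let ?S = "{x :: 3 \<Rightarrow> real. (\<forall>i\<in>?J. 0 \<le> x i) \<and> sum x ?J \<le> 1} \<inter> space (Pi\<^sub>M ?J (\<lambda>_. lborel))"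
  define K where "K = {x :: real^3. (\<forall>i\<in>?J. 0 \<le> x $ i) \<and> (\<Sum>i\<in>?J. x $ i) \<le> 1}"
  have card: "card ?J = 2"
    using exhaust_3[of j] by (auto simp: Compl_singletons_3)
  have "convex K"
  proof (rule convexI)
    fix x y :: "real^3" and u v :: real
    assume x: "x \<in> K" and y: "y \<in> K" and uv: "0 \<le> u" "0 \<le> v" "u + v = 1"
    have "u * (\<Sum>i\<in>?J. x $ i) + v * (\<Sum>i\<in>?J. y $ i) \<le> 1"
      using x y uv by (intro convex_bound_le) (auto simp: K_def)
    then show "u *\<^sub>R x + v *\<^sub>R y \<in> K"
      using x y uv by (auto simp: K_def sum.distrib sum_distrib_left)
  qed
  moreover have "?S \<in> sets (Pi\<^sub>M ?J (\<lambda>_. lborel))"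
  proof -
    have "?S = Pi\<^sub>E ?J (\<lambda>_. {0..}) \<inter> (\<lambda>x. sum x ?J) -` {..1} \<inter> space (Pi\<^sub>M ?J (\<lambda>_. lborel))"
      by (auto simp: space_PiM)
    also have "\<dots> \<in> sets (Pi\<^sub>M ?J (\<lambda>_. lborel))" by measurable
    finally show ?thesis .
  qed
  moreover have "(\<lambda>x. restrict (\<lambda>i. x $ i) ?J) ` K \<subseteq> ?S"
  proof (intro image_subsetI IntI CollectI conjI ballI)
    fix x assume x: "x \<in> K"
    show "0 \<le> restrict (\<lambda>i. x $ i) ?J i" if "i \<in> ?J" for i
      using x that unfolding K_def restrict_def by auto
    show "sum (restrict (\<lambda>i. x $ i) ?J) ?J \<le> 1"
      using x by (simp add: K_def)
    show "restrict (\<lambda>i. x $ i) ?J \<in> space (Pi\<^sub>M ?J (\<lambda>_. lborel))"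
      by (simp add: space_PiM)
  qed
  ultimately have "Vol 1 (convex hull {P, Q}) F \<le> 2 * emeasure (Pi\<^sub>M ?J (\<lambda>_. lborel)) ?S"
    using pos le by (intro Vol_edge_le[OF j PQ]) (auto simp: K_def coord_proj_def)
  also have "emeasure (Pi\<^sub>M ?J (\<lambda>_. lborel)) ?S = ennreal (1 / 2)"
    by (subst emeasure_std_simplex_aux) (simp_all add: card)
  also have "2 * ennreal (1 / 2) = 1"
    by (rule two_times_half_ennreal)
  finally show ?thesis .
qed

text \<open>The triangle spanned by \<open>0\<close>, \<open>(2, 0)\<close> and \<open>(1, 1)\<close>, or its mirror image, is covered by two
  rectangles of areas 1 and 1/2.\<close>

lemma Vol_edge_of_vertical_facet:
  fixes F :: "(real^3) set"
  assumes j: "3 \<in> unbounded_directions F" and P: "P = vertex_A \<or> P = vertex_B"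
  shows "Vol 1 (convex hull {P, vertex_C}) F \<le> 3"
proof -
  obtain a b :: 3 where ab: "{a, b} = {1, 2}" "a \<noteq> b" "P $ a = 2" "P $ b = 0"
    using P
  proof
    assume "P = vertex_A"
    then show ?thesis by (intro that[of 1 2]) auto
  next
    assume "P = vertex_B"
    then show ?thesis by (intro that[of 2 1]) auto
  qed
  have J: "- {3} = {a, b}" using Compl_singletons_3 ab by simp
  define R1 where "R1 = Pi\<^sub>E {a, b} (\<lambda>i. {0 :: real..if i = a then 2 else 1 / 2})"
  define R2 where "R2 = Pi\<^sub>E {a, b} (\<lambda>i. {1 / 2 :: real..if i = a then 3 / 2 else 1})"
  have sets: "R1 \<in> sets (Pi\<^sub>M {a, b} (\<lambda>_. lborel))" "R2 \<in> sets (Pi\<^sub>M {a, b} (\<lambda>_. lborel))"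
    unfolding R1_def R2_def by (auto intro!: sets_PiM_I_finite)
  have em: "emeasure (Pi\<^sub>M {a, b} (\<lambda>_. lborel)) R1 = 1" "emeasure (Pi\<^sub>M {a, b} (\<lambda>_. lborel)) R2 = ennreal (1 / 2)"
    unfolding R1_def R2_def using ab(2) by (subst emeasure_box; simp)+
  define K where "K = {x :: real^3. 0 \<le> x $ b \<and> x $ b \<le> x $ a \<and> x $ a + x $ b \<le> 2}"
  have "convex K"
  proof (rule convexI)
    fix x y :: "real^3" and u v :: real
    assume x: "x \<in> K" and y: "y \<in> K" and uv: "0 \<le> u" "0 \<le> v" "u + v = 1"
    have "u * (x $ a + x $ b) + v * (y $ a + y $ b) \<le> 2"
      using x y uv by (intro convex_bound_le) (auto simp: K_def)
    moreover have "u * x $ b \<le> u * x $ a" "v * y $ b \<le> v * y $ a"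
      using x y uv by (auto simp: K_def intro!: mult_left_mono)
    ultimately show "u *\<^sub>R x + v *\<^sub>R y \<in> K"
      using x y uv by (auto simp: K_def algebra_simps)
  qed
  moreover have "(\<lambda>x. restrict (\<lambda>i. x $ i) (- {3})) ` K \<subseteq> R1 \<union> R2"
  proof (rule image_subsetI)
    fix x assume x: "x \<in> K"
    show "restrict (\<lambda>i. x $ i) (- {3}) \<in> R1 \<union> R2"
    proof (cases "x $ b \<le> 1 / 2")
      case True
      then have "restrict (\<lambda>i. x $ i) {a, b} \<in> R1"
        using x ab(2) by (auto simp: R1_def K_def PiE_iff)
      then show ?thesis by (simp add: J)
    next
      case False
      then have "restrict (\<lambda>i. x $ i) {a, b} \<in> R2"
        using x ab(2) by (auto simp: R2_def K_def PiE_iff)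
      then show ?thesis by (simp add: J)
    qed
  qed
  moreover have "a \<noteq> 3" "b \<noteq> 3" using J by auto
  moreover have "vertex_C $ a = 1" "vertex_C $ b = 1"
    using ab(1,2) by (auto simp: doubleton_eq_iff)
  ultimately have "Vol 1 (convex hull {P, vertex_C}) F \<le> 2 * emeasure (Pi\<^sub>M (- {3}) (\<lambda>_. lborel)) (R1 \<union> R2)"
    using sets ab by (intro Vol_edge_le[OF j, of _ _ K]) (auto simp: K_def coord_proj_def vec_eq_iff J)
  also have "emeasure (Pi\<^sub>M (- {3}) (\<lambda>_. lborel)) (R1 \<union> R2) \<le> 1 + ennreal (1 / 2)"
    unfolding J using emeasure_subadditive[OF sets] em by simp
  also have "2 * (1 + ennreal (1 / 2)) = 3"
    by (simp only: distrib_left two_times_half_ennreal) simp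
  finally show ?thesis by (simp add: mult_left_mono)
qed

lemma newton_example: "newton (example_ideal :: ('k::field, 3) mpoly fract set) = polyhedron_I"
proof -
  have "{\<chi> j. real (Poly_Mapping.lookup v j) | v. emb (monomial v) \<in> (example_ideal :: ('k, 3) mpoly fract set)}
      = {\<chi> j. real (Poly_Mapping.lookup v j) | v. v \<in> power_exponents 1}"
    by (simp add: example_ideal_eq emb_monomial_in_mon_ideal_iff[OF upset_power_exponents])
  also have "\<dots> = lattice_points"
  proof -
    have "(\<chi> j. real (Poly_Mapping.lookup (exponent p q r) j)) = point (real p) (real q) (real r)" for p q r
      by (simp add: vec_eq_iff forall_3)
    note coords = this
    show ?thesis
    proof (intro equalityI subsetI)
      fix y assume "y \<in> {\<chi> j. real (Poly_Mapping.lookup v j) | v. v \<in> power_exponents 1}"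
      then obtain p q r where "y = (\<chi> j. real (Poly_Mapping.lookup (exponent p q r) j))"
        "2 * 1 \<le> p + q" "1 \<le> q + r" "1 \<le> p + r"
        unfolding power_exponents_def by blast
      then show "y \<in> lattice_points"
        unfolding coords by (auto intro: lattice_pointsI)
    next
      fix y assume "y \<in> lattice_points"
      then obtain p q r where "y = point (real p) (real q) (real r)" "exponent p q r \<in> power_exponents 1"
        unfolding lattice_points_def exponent_in_power_exponents_iff by auto
      then show "y \<in> {\<chi> j. real (Poly_Mapping.lookup v j) | v. v \<in> power_exponents 1}"
        by (auto simp: coords intro!: exI[of _ "exponent p q r"])
    qed
  qed
  finally show ?thesis by (simp add: newton_def)
qed

lemma conjectured_sum_le:
  "(\<Sum>F \<in> facets_F polyhedron_I 1. INF G \<in> {G \<in> bounded_faces 1 polyhedron_I. G \<subseteq> F}. Vol 1 G F) \<le> 5"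
proof -
  let ?F1 = "plane_section (point 1 1 0) 2"
  let ?F2 = "plane_section (point 0 1 1) 1"
  let ?F3 = "plane_section (point 1 0 1) 1"
  \<comment> \<open>Separate summands make the bound independent of the three facets being distinct.\<close>
  define g :: "(real^3) set \<Rightarrow> ennreal" where
    "g F = (if F = ?F1 then 3 else 0) + (if F = ?F2 then 1 else 0) + (if F = ?F3 then 1 else 0)" for F
  have sub: "facets_F polyhedron_I 1 \<subseteq> {?F1, ?F2, ?F3}"
  proof
    fix F assume "F \<in> facets_F polyhedron_I 1"
    then show "F \<in> {?F1, ?F2, ?F3}"
      by (rule facets_with_bounded_edge) blast
  qed
  have "(INF G \<in> {G \<in> bounded_faces 1 polyhedron_I. G \<subseteq> F}. Vol 1 G F) \<le> g F"
    if F: "F \<in> facets_F polyhedron_I 1" for F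
  proof -
    obtain j P where j: "j \<in> unbounded_directions F" and sub: "convex hull {P, vertex_C} \<subseteq> F"
      and bf: "convex hull {P, vertex_C} \<in> bounded_faces 1 polyhedron_I"
      and cases: "(j = 3 \<and> (P = vertex_A \<or> P = vertex_B) \<and> F = ?F1) \<or>
        (j = 1 \<and> P = vertex_A \<and> F = ?F2) \<or> (j = 2 \<and> P = vertex_B \<and> F = ?F3)"
      using F by (rule facets_with_bounded_edge)
    have "(INF G \<in> {G \<in> bounded_faces 1 polyhedron_I. G \<subseteq> F}. Vol 1 G F) \<le> Vol 1 (convex hull {P, vertex_C}) F"
      using sub bf by (intro INF_lower) auto
    also have "\<dots> \<le> g F"
      using cases
    proof (elim disjE conjE)
      assume a: "j = 3" "P = vertex_A" "F = ?F1"
      then have "Vol 1 (convex hull {P, vertex_C}) F \<le> 3" using j by (intro Vol_edge_of_vertical_facet) auto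
      also have "3 \<le> g F" by (simp add: g_def a add_increasing2 add.assoc)
      finally show ?thesis .
    next
      assume a: "j = 3" "P = vertex_B" "F = ?F1"
      then have "Vol 1 (convex hull {P, vertex_C}) F \<le> 3" using j by (intro Vol_edge_of_vertical_facet) auto
      also have "3 \<le> g F" by (simp add: g_def a add_increasing2 add.assoc)
      finally show ?thesis .
    next
      assume a: "j = 1" "P = vertex_A" "F = ?F2"
      have "Vol 1 (convex hull {P, vertex_C}) F \<le> 1"
        by (intro Vol_standard_triangle[OF j])
          (auto simp: a Compl_singletons_3 coord_proj_def vec_eq_iff forall_3)
      also have "1 \<le> g F" by (simp add: g_def a add_increasing2 add_increasing)
      finally show ?thesis .
    next
      assume a: "j = 2" "P = vertex_B" "F = ?F3"
      have "Vol 1 (convex hull {P, vertex_C}) F \<le> 1"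
        by (intro Vol_standard_triangle[OF j])
          (auto simp: a Compl_singletons_3 coord_proj_def vec_eq_iff forall_3)
      also have "1 \<le> g F" by (simp add: g_def a add_increasing2 add_increasing)
      finally show ?thesis .
    qed
    finally show ?thesis .
  qed
  then have "(\<Sum>F \<in> facets_F polyhedron_I 1. INF G \<in> {G \<in> bounded_faces 1 polyhedron_I. G \<subseteq> F}. Vol 1 G F)
      \<le> (\<Sum>F \<in> facets_F polyhedron_I 1. g F)"
    by (rule sum_mono)
  also have "\<dots> \<le> (\<Sum>F \<in> {?F1, ?F2, ?F3}. g F)"
    by (rule sum_mono2[OF _ sub]) simp_all
  also have "\<dots> = 5"
    unfolding g_def sum.distrib by (simp add: sum.delta)
  finally show ?thesis .
qed

theorem formula_fails_for_edges:
  "\<not> achilles_manaresi_formula (example_ideal :: ('k::field, 3) mpoly fract set) 1"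
proof
  assume "achilles_manaresi_formula (example_ideal :: ('k, 3) mpoly fract set) 1"
  then have "of_nat (loc_mult (example_ideal :: ('k, 3) mpoly fract set) (CARD(3) - (1 + 1))) \<le> (5 :: ennreal)"
    unfolding achilles_manaresi_formula_def newton_example using conjectured_sum_le by (simp only:)
  moreover have "CARD(3) - (1 + 1) = (1 :: nat)" by simp
  ultimately have "(of_nat 6 :: ennreal) \<le> 5" by (simp only: loc_mult_example)
  then show False by simp
qed

theorem theorem5p2:
  fixes I :: "('k::field, 3) mpoly fract set" and x :: "3 \<Rightarrow> ('k, 3) mpoly fract"
  defines "x \<equiv> (\<lambda>j. emb (poly_var j))"
  defines "I \<equiv> Idl\<^bsub>loc_ring\<^esub> {x 1 ^ 2 * x 3, x 2 ^ 2 * x 3, x 1 * x 2}"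
  shows "\<not> (\<forall>k\<le>CARD(3) - 1. achilles_manaresi_formula I k) \<and>
    \<not> (\<forall>J :: ('k, 3) mpoly fract set.
         monomial_ideal J \<and> J \<noteq> {0} \<and> J \<noteq> carrier loc_ring \<longrightarrow>
         (\<forall>k\<le>CARD(3) - 1. achilles_manaresi_formula J k))"
proof -
  have var: "x 1 = emb (monomial (exponent 1 0 0))" "x 2 = emb (monomial (exponent 0 1 0))"
    "x 3 = emb (monomial (exponent 0 0 1))"
    by (simp_all add: x_def poly_var_def exponent_def)
  have "{x 1 ^ 2 * x 3, x 2 ^ 2 * x 3, x 1 * x 2} = (\<lambda>v. emb (monomial v)) ` generators"
    by (simp add: generators_def var power2_eq_square exponent_add numeral_2_eq_2 flip: emb_monomial_add)
  then have I: "I = example_ideal"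
    by (simp add: I_def example_ideal_def)
  have "\<not> achilles_manaresi_formula I 1"
    unfolding I by (rule formula_fails_for_edges)
  then have fail: "\<not> (\<forall>k\<le>CARD(3) - 1. achilles_manaresi_formula I k)"
    by (auto intro!: exI[of _ 1])
  have "monomial_ideal I"
    unfolding monomial_ideal_def I example_ideal_def by blast
  moreover have "I \<noteq> {0}"
  proof
    assume "I = {0}"
    then have "emb (monomial (exponent 1 1 0)) = (0 :: ('k, 3) mpoly fract)"
      using emb_monomial_in_mon_ideal_iff[OF upset_power_exponents, where 'k = 'k, of "exponent 1 1 0" 1]
      by (simp add: I example_ideal_eq exponent_in_power_exponents_iff)
    then have "emb (monomial (exponent 1 1 0)) \<in> (mon_ideal {} :: ('k, 3) mpoly fract set)"
      by (simp add: zero_in_mon_ideal)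
    then show False
      by (subst (asm) emb_monomial_in_mon_ideal_iff) (auto simp: upset_def)
  qed
  moreover have "I \<noteq> carrier loc_ring"
  proof
    assume "I = carrier loc_ring"
    then have "mon_ideal (power_exponents 1) = (mon_ideal UNIV :: ('k, 3) mpoly fract set)"
      by (simp add: I example_ideal_eq)
    then have "exponent 0 0 0 \<in> power_exponents 1"
      using emb_monomial_in_mon_ideal_iff[OF upset_power_exponents, where 'k = 'k, of "exponent 0 0 0" 1]
        emb_monomial_in_mon_ideal_iff[OF upset_UNIV, where 'k = 'k, of "exponent 0 0 0"] by simp
    then show False
      by (simp add: exponent_in_power_exponents_iff)
  qed
  ultimately show ?thesis using fail by blast
qed

end
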